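(* Let $k\ge 3$ be an integer, $n=k^2$, and let $H$ be a 3-connected plane graph with $n$ vertices having the following property: its vertex set can be split into $k$ equal parts $V(H)=V_1\cup\ldots\cup V_k$ (pairwise disjoint, each of size $k$) so that each $H[V_i]$ is a triangulation and these $k$ triangulations lie in the outer faces of each other. Let $X$ be an arbitrary set of $n$ points on the boundary $\Gamma$ of a convex plane body. Then there is a drawing $\pi:V(H)\to X$ such that $\mathit{fix}(H,\pi)\le 2\sqrt{n}+1$.
   Context: Graphs are finite and simple. A plane graph is a planar graph given together with a crossing-free embedding in $\mathbb{R}^2$, whose edges are simple curves (not necessarily straight). $H[V_i]$ denotes the subgraph of $H$ induced on $V_i$, with the plane embedding inherited from $H$; it is a triangulation if it is a maximal planar graph, i.e. every face (including the outer one) is bounded by a triangle. That the triangulations lie in the outer faces of each other means that for all $i\ne j$, $H[V_j]$ lies in the outer (unbounded) face of $H[V_i]$. A convex plane body is a compact convex subset of $\mathbb{R}^2$ with nonempty interior; the points of $X$ need not be in strictly convex position. A drawing of a planar graph $G$ is an arbitrary injective map $\pi:V(G)\to\mathbb{R}^2$; each edge $uv$ is drawn as the straight line segment with endpoints $\pi(u)$ and $\pi(v)$. Edge crossings and overlaps are allowed in a drawing, so $\pi$ need not be a plane drawing. A drawing is a plane straight line drawing if it is crossing-free (no edge segment contains a vertex point other than its endpoints, and two edge segments meet only in a common endpoint). For a drawing $\pi$ of a planar graph $G$, $$\mathit{fix}(G,\pi)=\max_{\pi'}\left|\{v\in V(G):\pi'(v)=\pi(v)\}\right|,$$ where the maximum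 is taken over all plane straight line drawings $\pi'$ of the abstract graph $G$. *)

theory Defs
  imports "HOL-Analysis.Analysis"
begin

text \<open>The Euclidean plane is rendered as \<^typ>\<open>complex\<close>, the plane for which the library
  develops Jordan curves. A graph is given by a vertex set \<open>V\<close> and a set \<open>E\<close> of
  two-element subsets of \<open>V\<close>.\<close>

definition simple_graph :: "'v set \<Rightarrow> 'v set set \<Rightarrow> bool" where
  "simple_graph V E \<longleftrightarrow> finite V \<and> (\<forall>e\<in>E. e \<subseteq> V \<and> card e = 2)"

definition induced_edges :: "'v set set \<Rightarrow> 'v set \<Rightarrow> 'v set set" where
  "induced_edges E U = {e \<in> E. e \<subseteq> U}"

definition connected_graph :: "'v set \<Rightarrow> 'v set set \<Rightarrow> bool" where
  "connected_graph V E \<longleftrightarrow> V \<noteq> {} \<and> (\<forall>u\<in>V. \<forall>v\<in>V. (u, v) \<in> {(x, y). {x, y} \<in> E}\<^sup>*)"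

definition vertex_connected :: "nat \<Rightarrow> 'v set \<Rightarrow> 'v set set \<Rightarrow> bool" where
  "vertex_connected c V E \<longleftrightarrow>
     card V > c \<and>
     (\<forall>S. S \<subseteq> V \<and> card S < c \<longrightarrow> connected_graph (V - S) (induced_edges E (V - S)))"

text \<open>In a plane graph the vertex \<open>v\<close> is placed at \<open>pos v\<close> and the edge \<open>e\<close> is drawn as the
  simple curve \<open>crv e\<close>; the direction in which the curve is traversed is irrelevant.\<close>

definition plane_graph ::
    "'v set \<Rightarrow> 'v set set \<Rightarrow> ('v \<Rightarrow> complex) \<Rightarrow> ('v set \<Rightarrow> real \<Rightarrow> complex) \<Rightarrow> bool" where
  "plane_graph V E pos crv \<longleftrightarrow>
     simple_graph V E \<and> inj_on pos V \<and>
     (\<forall>e\<in>E. arc (crv e) \<and> {pathstart (crv e), pathfinish (crv e)} = pos ` e \<and>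
            path_image (crv e) \<inter> pos ` V = pos ` e) \<and>
     (\<forall>e\<in>E. \<forall>f\<in>E. e \<noteq> f \<longrightarrow> path_image (crv e) \<inter> path_image (crv f) = pos ` (e \<inter> f))"

definition plane_image ::
    "'v set \<Rightarrow> 'v set set \<Rightarrow> ('v \<Rightarrow> complex) \<Rightarrow> ('v set \<Rightarrow> real \<Rightarrow> complex) \<Rightarrow> complex set" where
  "plane_image V E pos crv = pos ` V \<union> (\<Union>e\<in>E. path_image (crv e))"

definition faces ::
    "'v set \<Rightarrow> 'v set set \<Rightarrow> ('v \<Rightarrow> complex) \<Rightarrow> ('v set \<Rightarrow> real \<Rightarrow> complex) \<Rightarrow> complex set set" where
  "faces V E pos crv = components (- plane_image V E pos crv)"

text \<open>The plane image is compact, so its complement has exactly one unbounded component,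
  and \<^const>\<open>outside\<close> is that component.\<close>

definition outer_face ::
    "'v set \<Rightarrow> 'v set set \<Rightarrow> ('v \<Rightarrow> complex) \<Rightarrow> ('v set \<Rightarrow> real \<Rightarrow> complex) \<Rightarrow> complex set" where
  "outer_face V E pos crv = outside (plane_image V E pos crv)"

definition plane_triangulation ::
    "'v set \<Rightarrow> 'v set set \<Rightarrow> ('v \<Rightarrow> complex) \<Rightarrow> ('v set \<Rightarrow> real \<Rightarrow> complex) \<Rightarrow> bool" where
  "plane_triangulation V E pos crv \<longleftrightarrow>
     plane_graph V E pos crv \<and>
     (\<forall>F \<in> faces V E pos crv. \<exists>a b c. a \<noteq> b \<and> b \<noteq> c \<and> a \<noteq> c \<and>
        {a, b} \<in> E \<and> {b, c} \<in> E \<and> {a, c} \<in> E \<and>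
        frontier F = path_image (crv {a, b}) \<union> path_image (crv {b, c}) \<union> path_image (crv {a, c}))"

definition drawing :: "'v set \<Rightarrow> ('v \<Rightarrow> complex) \<Rightarrow> bool" where
  "drawing V p \<longleftrightarrow> inj_on p V"

definition plane_straight_line_drawing ::
    "'v set \<Rightarrow> 'v set set \<Rightarrow> ('v \<Rightarrow> complex) \<Rightarrow> bool" where
  "plane_straight_line_drawing V E p \<longleftrightarrow>
     drawing V p \<and>
     (\<forall>u v. {u, v} \<in> E \<longrightarrow> closed_segment (p u) (p v) \<inter> p ` V = {p u, p v}) \<and>
     (\<forall>u v x y. {u, v} \<in> E \<and> {x, y} \<in> E \<and> {u, v} \<noteq> {x, y} \<longrightarrow>
        closed_segment (p u) (p v) \<inter> closed_segment (p x) (p y) = p ` ({u, v} \<inter> {x, y}))"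

text \<open>The supremum is over naturals bounded by \<open>card V\<close>. For a planar graph the set of plane
  straight line drawings is nonempty (Wagner, Fary, Stein), so the supremum is a maximum.\<close>

definition fix_count :: "'v set \<Rightarrow> 'v set set \<Rightarrow> ('v \<Rightarrow> complex) \<Rightarrow> nat" where
  "fix_count V E p =
     (SUP p' \<in> {p'. plane_straight_line_drawing V E p'}. card {v \<in> V. p' v = p v})"

definition convex_body :: "complex set \<Rightarrow> bool" where
  "convex_body K \<longleftrightarrow> compact K \<and> convex K \<and> interior K \<noteq> {}"

end

(*
  Number the points of X cyclically along the boundary and send V_i to the points whose number is i
  modulo k. Fix a plane straight line drawing. The facial triangles of each triangulation are
  non-separating and every edge lies on two of them, so in the drawing one facial triangle of V_i
  contains V_i, and the others are empty and cover it. By 3-connectivity the facial triangles other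
  than the outer one of the plane graph do not separate H either. Hence the convex hulls of the V_i
  are pairwise disjoint, with at most one exceptional V_j, which surrounds the others: they all lie
  in one triangle of V_j, and V_j is cut into three classes by the sides of this triangle. In any
  case the fixed vertices fall into at most k + 2 classes with pairwise disjoint convex hulls, so
  along the boundary the classes do not cross. Two vertices of a class are a multiple of k apart,
  and a non-crossing family of m classes of this kind in k^2 cyclic positions has at most m + k - 1
  elements.
*)

theory Submission
  imports Defs
begin

section \<open>Non-crossing colourings\<close>

text \<open>The obstacle is that a straight line drawing of H need not resemble the given plane
  embedding: a different face may become the unbounded one. No uniqueness theorem for embeddings is
  invoked. The curves only serve to extract combinatorial facts: which vertex triples bound faces,
  that deleting such a triple does not disconnect, that every edge lies in two of them, and that
  edges leaving a part start at its outer triple. These facts are then read in the drawing by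
  elementary geometry. Two exceptional triangulations cannot coexist, since the outer triangle of
  each in the drawing would contain all of H. The three classes of the exceptional part replace a
  single one, so m = (k - 1) + 3 = k + 2, and m + k - 1 = 2 k + 1 is the claimed bound. The
  combinatorial facts require a vertex of the part off the triangle, that is k >= 4; for k = 3 the
  bound is 7 and is obtained directly. Convexity of the body enters only through the numbering:
  chords joining alternating boundary points meet.\<close>

text \<open>Cutting at the next occurrence \<open>q\<close> of the first colour leaves two pieces without common
  colours. The gap up to \<open>q\<close> is a multiple of \<open>k\<close> and exceeds the length of the piece inside it,
  which pays for the repeated colour.\<close>

lemma noncrossing_card:
  fixes F :: "nat set" and col :: "nat \<Rightarrow> 'c"
  assumes "finite F" "F \<noteq> {}"
    and "\<And>p q. p \<in> F \<Longrightarrow> q \<in> F \<Longrightarrow> p < q \<Longrightarrow> col p = col q \<Longrightarrow> k dvd q - p"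
    and "\<And>p q r s. {p, q, r, s} \<subseteq> F \<Longrightarrow> p < q \<Longrightarrow> q < r \<Longrightarrow> r < s \<Longrightarrow>
           col p = col r \<Longrightarrow> col q = col s \<Longrightarrow> col p = col q"
  shows "k * card F \<le> k * card (col ` F) + (Max F - Min F)"
  using assms
proof (induction "card F" arbitrary: F rule: less_induct)
  case less
  define p where "p = Min F"
  have p: "p \<in> F" "\<And>x. x \<in> F \<Longrightarrow> p \<le> x"
    using less.prems(1,2) by (auto simp: p_def)
  have maxF: "\<And>x. x \<in> F \<Longrightarrow> x \<le> Max F" using less.prems(1,2) by auto
  show ?case
  proof (cases "\<exists>q\<in>F. q > p \<and> col q = col p")
    case False
    define R where "R = F - {p}"
    show ?thesis
    proof (cases "R = {}")
      case True
      then have "F = {p}" using p R_def by auto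
      then show ?thesis by simp
    next
      case nonempty: False
      have card: "card F = Suc (card R)" 
        unfolding R_def by (rule card.remove[OF less.prems(1) p(1)])
      have "k * card R \<le> k * card (col ` R) + (Max R - Min R)"
      proof (rule less.hyps)
        fix a b c d
        assume h: "{a, b, c, d} \<subseteq> R" "a < b" "b < c" "c < d" "col a = col c" "col b = col d"
        then have "{a, b, c, d} \<subseteq> F" unfolding R_def by auto
        from this h(2-) show "col a = col b" by (rule less.prems(4))
      next
        show "k dvd b - a" if "a \<in> R" "b \<in> R" "a < b" "col a = col b" for a b
          using that less.prems(3) unfolding R_def by blast
        show "finite R" "card R < card F" using less.prems(1) card by (simp_all add: R_def)
        show "R \<noteq> {}" by (fact nonempty)
      qed
      moreover have "col p \<notin> col ` R"
      proof
        assume "col p \<in> col ` R"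
        then obtain x where x: "x \<in> R" "col x = col p" by (metis imageE)
        then have "x \<in> F" "x \<noteq> p" unfolding R_def by blast+
        with p(2)[of x] x False show False by auto
      qed
      then have "card (insert (col p) (col ` R)) = Suc (card (col ` R))"
        using less.prems(1) R_def by (intro card_insert_disjoint) auto
      moreover have "col ` F = insert (col p) (col ` R)"
        using p(1) unfolding R_def by blast
      moreover have "Max R \<le> Max F" "Min F \<le> Min R"
        using less.prems(1,2) nonempty by (auto simp: R_def intro!: Max_mono Min_antimono)
      then have "Max R - Min R \<le> Max F - Min F" by simp
      ultimately show ?thesis using card by simp
    qed
  next
    case True
    define q where "q = (LEAST q. q \<in> F \<and> q > p \<and> col q = col p)"
    have "q \<in> F \<and> q > p \<and> col q = col p"
      unfolding q_def by (rule LeastI_ex) (use True in auto)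
    then have q: "q \<in> F" "q > p" "col q = col p" by auto
    have q_least: "col x \<noteq> col p" if "x \<in> F" "p < x" "x < q" for x
      using not_less_Least that unfolding q_def by blast
    define S where "S = {x \<in> F. p < x \<and> x < q}"
    define R where "R = {x \<in> F. q \<le> x}"
    have F: "F = insert p (S \<union> R)"
      unfolding S_def R_def using p q by (auto simp: le_less not_less) 
    have fin: "finite S" "finite R" unfolding S_def R_def using less.prems(1,2) by auto
    have "p \<notin> S \<union> R" "S \<inter> R = {}" unfolding S_def R_def using q by auto
    then have card: "card F = Suc (card S + card R)"
      using fin by (subst F) (simp add: card_Un_disjoint)
    have disj: "col ` S \<inter> col ` R = {}"
    proof (rule ccontr)
      assume "col ` S \<inter> col ` R \<noteq> {}"
      then obtain x y where xy: "x \<in> S" "y \<in> R" "col x = col y" by auto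
      have "col x \<noteq> col p" using xy q_least unfolding S_def by auto
      then have "y \<noteq> q" using xy q by auto
      then have "col p = col x"
        using xy p q less.prems(4)[of p x q y] by (auto simp: S_def R_def)
      with \<open>col x \<noteq> col p\<close> show False by simp
    qed
    have "col ` F = col ` S \<union> col ` R"
    proof -
      have "col p \<in> col ` R"
        using q by (metis (mono_tags, lifting) R_def image_eqI mem_Collect_eq order_refl)
      then show ?thesis by (subst F) (auto simp: image_Un)
    qed
    then have cardc: "card (col ` F) = card (col ` S) + card (col ` R)"
      using disj fin by (simp add: card_Un_disjoint)
    have qR: "q \<in> R" using q unfolding R_def by simp
    have IH: "k * card G \<le> k * card (col ` G) + (Max G - Min G)"
      if "G = S \<or> G = R" "G \<noteq> {}" for G
    proof -
      have GF: "G \<subseteq> F" using that F by blast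
      show ?thesis
      proof (rule less.hyps)
        fix a b c d
        assume h: "{a, b, c, d} \<subseteq> G" "a < b" "b < c" "c < d" "col a = col c" "col b = col d"
        then have "{a, b, c, d} \<subseteq> F" using GF by blast
        from this h(2-) show "col a = col b" by (rule less.prems(4))
      next
        show "card G < card F" using card that by auto
        show "finite G" using that fin by blast
        show "k dvd q - p" if "p \<in> G" "q \<in> G" "p < q" "col p = col q" for p q
          using that GF less.prems(3) by blast
      qed (use that in auto)
    qed
    have minR: "Min R = q" using qR fin by (intro Min_eqI) (auto simp: R_def)
    have maxR: "Max R = Max F"
    proof (rule Max_eqI[symmetric])
      show "Max R \<in> F" using Max_in[OF fin(2)] qR unfolding R_def by blast
      fix y assume "y \<in> F"
      show "y \<le> Max R"
      proof (cases "q \<le> y")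
        case True
        with \<open>y \<in> F\<close> fin show ?thesis by (simp add: R_def)
      next
        case False
        with Max_ge[OF fin(2) qR] show ?thesis by simp
      qed
    qed (use less.prems(1,2) in auto)
    have R: "k * card R \<le> k * card (col ` R) + (Max F - q)"
      using IH[of R] qR minR maxR by auto
    have dvd: "k dvd q - p" using less.prems(3) p q by metis
    have S: "k * Suc (card S) \<le> k * card (col ` S) + (q - p)"
    proof (cases "S = {}")
      case True
      then show ?thesis using dvd q by (simp add: dvd_imp_le)
    next
      case False
      have "Max S < q" "Min S > p" using False fin by (auto simp: S_def)
      moreover have "Min S \<le> Max S" using False fin by auto
      ultimately have "Max S - Min S < q - p" by arith
      with IH[OF disjI1[OF refl] False] have lt: "k * card S < k * card (col ` S) + (q - p)" by linarith
      \<comment> \<open>All terms are now multiples of \<open>k\<close>, so the strict inequality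
        can be divided by \<open>k\<close> and gains a whole unit: it accounts for the point
        \<open>p\<close>.\<close>
      obtain m where "q - p = k * m" using dvd by auto
      with lt have "k * card S < k * (card (col ` S) + m)" by (simp add: distrib_left)
      then have "card S < card (col ` S) + m" by simp
      then have "k * Suc (card S) \<le> k * (card (col ` S) + m)" by (intro mult_le_mono2) simp
      with \<open>q - p = k * m\<close> show ?thesis by (simp add: distrib_left)
    qed
    have "q \<le> Max F" using maxF q by simp
    with R S q have "k * card R + k * Suc (card S) \<le> k * card (col ` R) + k * card (col ` S) + (Max F - p)"
      by linarith
    then show ?thesis
      by (simp add: card cardc p_def distrib_left algebra_simps)
  qed
qed

text \<open>The span \<open>Max F - Min F\<close> stays below \<open>k * k\<close>, so after
  division by \<open>k\<close> it adds less than \<open>k\<close> to the number of colours. The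
  strictness saves one unit in the final bound.\<close>

lemma noncrossing_card_square:
  fixes F :: "nat set" and col :: "nat \<Rightarrow> 'c"
  assumes "F \<subseteq> {..<k * k}" "k > 0"
    and "\<And>p q. p \<in> F \<Longrightarrow> q \<in> F \<Longrightarrow> p < q \<Longrightarrow> col p = col q \<Longrightarrow> k dvd q - p"
    and "\<And>p q r s. {p, q, r, s} \<subseteq> F \<Longrightarrow> p < q \<Longrightarrow> q < r \<Longrightarrow> r < s \<Longrightarrow>
           col p = col r \<Longrightarrow> col q = col s \<Longrightarrow> col p = col q"
  shows "card F < card (col ` F) + k"
proof (cases "F = {}")
  case False
  have fin: "finite F" using assms(1) finite_subset by blast
  then have "Max F < k * k" using Max_in[OF fin False] assms(1) by auto
  moreover have "k * card F \<le> k * card (col ` F) + (Max F - Min F)"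
    by (rule noncrossing_card) (use fin False assms(3,4) in auto)
  ultimately have "k * card F < k * (card (col ` F) + k)" by (simp add: distrib_left)
  then show ?thesis by simp
qed (use assms in auto)

text \<open>The coefficients come from the identity sin(\<gamma> - \<alpha>) cis \<beta> =
  sin(\<gamma> - \<beta>) cis \<alpha> + sin(\<beta> - \<alpha>) cis \<gamma>, rescaled by the
  radii. All three sines are positive because the angles span less than pi.\<close>

lemma scaled_cis_between:
  assumes "\<alpha> < \<beta>" "\<beta> < \<gamma>" "\<gamma> < \<alpha> + pi" "r > 0" "r1 > 0" "r2 > 0"
  obtains s t where "s > 0" "t > 0"
    "rcis r \<beta> = s *\<^sub>R rcis r1 \<alpha> + t *\<^sub>R rcis r2 \<gamma>"
proof
  define D where "D = sin (\<gamma> - \<alpha>)"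
  have D: "D > 0" unfolding D_def using assms by (intro sin_gt_zero) auto
  show "r * sin (\<gamma> - \<beta>) / (D * r1) > 0" "r * sin (\<beta> - \<alpha>) / (D * r2) > 0"
    using assms D by (auto intro!: divide_pos_pos mult_pos_pos sin_gt_zero)
  have 1: "D * cos \<beta> = sin (\<gamma> - \<beta>) * cos \<alpha> + sin (\<beta> - \<alpha>) * cos \<gamma>"
    unfolding D_def sin_diff by (simp add: algebra_simps)
  have 2: "D * sin \<beta> = sin (\<gamma> - \<beta>) * sin \<alpha> + sin (\<beta> - \<alpha>) * sin \<gamma>"
    unfolding D_def sin_diff by (simp add: algebra_simps)
  have 3: "cos \<beta> = sin (\<gamma> - \<beta>) / D * cos \<alpha> + sin (\<beta> - \<alpha>) / D * cos \<gamma>"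
    using 1 D by (simp add: field_simps)
  have 4: "sin \<beta> = sin (\<gamma> - \<beta>) / D * sin \<alpha> + sin (\<beta> - \<alpha>) / D * sin \<gamma>"
    using 2 D by (simp add: field_simps)
  show "rcis r \<beta> = (r * sin (\<gamma> - \<beta>) / (D * r1)) *\<^sub>R rcis r1 \<alpha>
      + (r * sin (\<beta> - \<alpha>) / (D * r2)) *\<^sub>R rcis r2 \<gamma>"
    using assms by (simp add: complex_eq_iff 3 4 algebra_simps)
qed

section \<open>Points on the boundary of a convex body\<close>

text \<open>If \<open>s + t < 1\<close>, then \<open>x2\<close> would lie strictly between the
  interior point 0 and a point of the segment from \<open>x1\<close> to \<open>x3\<close>, hence in
  the interior. So \<open>s + t\<close> is at least 1, and since \<open>c\<close> is nonnegative the
  combination stays beyond the line.\<close>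

lemma boundary_point_in_cone_beyond:
  fixes K :: "complex set"
  assumes K: "convex K" "0 \<in> interior K"
    and x: "x1 \<in> closure K" "x3 \<in> closure K" "x2 \<notin> interior K"
    and eq: "x2 = s *\<^sub>R x1 + t *\<^sub>R x3" and pos: "s > 0" "t > 0"
    and c: "c \<ge> 0" "a \<bullet> x1 > c" "a \<bullet> x3 > c"
  shows "a \<bullet> x2 > c"
proof -
  have "s + t \<ge> 1"
  proof (rule ccontr)
    assume less: "\<not> s + t \<ge> 1"
    define w where "w = (s / (s + t)) *\<^sub>R x1 + (t / (s + t)) *\<^sub>R x3"
    have "s / (s + t) + t / (s + t) = 1" using pos by (simp flip: add_divide_distrib)
    then have w: "w \<in> closure K"
      unfolding w_def using K(1) x pos by (intro convexD[OF convex_closure]) auto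
    have "a \<bullet> w = s / (s + t) * (a \<bullet> x1) + t / (s + t) * (a \<bullet> x3)"
      by (simp add: w_def inner_add_right)
    also have "\<dots> > 0" using pos c by (intro add_pos_pos mult_pos_pos) auto
    finally have "w \<noteq> 0" by auto
    have "x2 = (s + t) *\<^sub>R w"
      using pos by (simp add: eq w_def scaleR_add_right)
    then have "x2 \<in> open_segment 0 w"
      using less pos \<open>w \<noteq> 0\<close> by (auto simp: in_segment intro!: exI[of _ "s + t"])
    with in_interior_closure_convex_segment[OF K w] x(3) show False by auto
  qed
  have "c \<le> (s + t) * c" using c \<open>s + t \<ge> 1\<close> by (simp add: mult_le_cancel_right1)
  also have "\<dots> < s * (a \<bullet> x1) + t * (a \<bullet> x3)"
    unfolding distrib_right using pos c by (intro add_strict_mono mult_strict_left_mono) auto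
  also have "\<dots> = a \<bullet> x2" by (simp add: eq inner_add_right)
  finally show ?thesis .
qed

lemma rcis_plus_2pi: "rcis r (\<theta> + 2 * pi) = rcis r \<theta>"
  by (simp add: rcis_def cis.ctr)

text \<open>The points at \<beta> and \<delta> lie beyond a line that does not have the origin
  beyond it. If their angular distance \<delta> - \<beta> is less than pi, their cone contains the
  point at \<gamma>; if it is more, their cone on the other side contains the point at \<alpha>; if
  it is exactly pi they are opposite, which two positive inner products exclude.\<close>

lemma boundary_points_not_separated:
  fixes K :: "complex set"
  assumes K: "convex K" "0 \<in> interior K"
    and angles: "\<alpha> < \<beta>" "\<beta> < \<gamma>" "\<gamma> < \<delta>" "\<delta> < \<alpha> + 2 * pi"
    and r: "r1 > 0" "r2 > 0" "r3 > 0" "r4 > 0"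
    and x: "{rcis r1 \<alpha>, rcis r2 \<beta>, rcis r3 \<gamma>, rcis r4 \<delta>} \<subseteq> closure K - interior K"
    and c: "c \<ge> 0" "a \<bullet> rcis r2 \<beta> > c" "a \<bullet> rcis r4 \<delta> > c"
  shows "a \<bullet> rcis r1 \<alpha> > c \<or> a \<bullet> rcis r3 \<gamma> > c"
proof -
  consider "\<delta> < \<beta> + pi" | "\<delta> = \<beta> + pi" | "\<delta> > \<beta> + pi" by linarith
  then show ?thesis
  proof cases
    case 1
    obtain s t where "s > 0" "t > 0" "rcis r3 \<gamma> = s *\<^sub>R rcis r2 \<beta> + t *\<^sub>R rcis r4 \<delta>"
      using scaled_cis_between[of \<beta> \<gamma> \<delta> r3 r2 r4] angles r 1 by auto
    then show ?thesis
      using boundary_point_in_cone_beyond[OF K, of "rcis r2 \<beta>" "rcis r4 \<delta>" "rcis r3 \<gamma>" s t c a] x c by auto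
  next
    case 2
    have "r2 *\<^sub>R rcis r4 \<delta> = - (r4 *\<^sub>R rcis r2 \<beta>)"
      by (simp add: 2 complex_eq_iff)
    then have "r2 * (a \<bullet> rcis r4 \<delta>) = - (r4 * (a \<bullet> rcis r2 \<beta>))"
      by (metis inner_minus_right inner_scaleR_right)
    moreover have "r2 * (a \<bullet> rcis r4 \<delta>) > 0" "r4 * (a \<bullet> rcis r2 \<beta>) > 0"
      using r c by auto
    ultimately show ?thesis by linarith
  next
    case 3
    obtain s t where "s > 0" "t > 0"
      "rcis r1 (\<alpha> + 2 * pi) = s *\<^sub>R rcis r4 \<delta> + t *\<^sub>R rcis r2 (\<beta> + 2 * pi)"
      using scaled_cis_between[of \<delta> "\<alpha> + 2 * pi" "\<beta> + 2 * pi" r1 r4 r2] angles r 3 by auto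
    then show ?thesis
      using boundary_point_in_cone_beyond[OF K, of "rcis r4 \<delta>" "rcis r2 \<beta>" "rcis r1 \<alpha>" s t c a] x c
      by (auto simp: rcis_plus_2pi)
  qed
qed

text \<open>Disjoint chords would be strictly separated by a line. The chord that this line
  separates from the origin then has its ends beyond the line and both ends of the other chord
  before it, against \<open>boundary_points_not_separated\<close>.\<close>

lemma diagonals_meet:
  fixes K :: "complex set"
  assumes K: "convex K" "0 \<in> interior K"
    and angles: "\<alpha> < \<beta>" "\<beta> < \<gamma>" "\<gamma> < \<delta>" "\<delta> < \<alpha> + 2 * pi"
    and r: "r1 > 0" "r2 > 0" "r3 > 0" "r4 > 0"
    and x: "{rcis r1 \<alpha>, rcis r2 \<beta>, rcis r3 \<gamma>, rcis r4 \<delta>} \<subseteq> closure K - interior K"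
  shows "closed_segment (rcis r1 \<alpha>) (rcis r3 \<gamma>) \<inter> closed_segment (rcis r2 \<beta>) (rcis r4 \<delta>) \<noteq> {}"
proof
  assume "closed_segment (rcis r1 \<alpha>) (rcis r3 \<gamma>) \<inter> closed_segment (rcis r2 \<beta>) (rcis r4 \<delta>) = {}"
  then obtain a b where ab: "\<forall>x \<in> closed_segment (rcis r1 \<alpha>) (rcis r3 \<gamma>). a \<bullet> x < b"
    "\<forall>x \<in> closed_segment (rcis r2 \<beta>) (rcis r4 \<delta>). a \<bullet> x > b"
    using separating_hyperplane_compact_closed[of "closed_segment (rcis r1 \<alpha>) (rcis r3 \<gamma>)"
        "closed_segment (rcis r2 \<beta>) (rcis r4 \<delta>)"]
    by auto
  show False
  proof (cases "b \<ge> 0")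
    case True
    with boundary_points_not_separated[OF K angles r x, of b a] ab
    have "a \<bullet> rcis r1 \<alpha> > b \<or> a \<bullet> rcis r3 \<gamma> > b" by blast
    with ab(1) show False by (meson ends_in_segment less_asym)
  next
    case False
    \<comment> \<open>Starting the cyclic order at \<delta> moves \<alpha> and \<gamma> to the
      second and fourth places, where the previous lemma expects the chord beyond the line.\<close>
    have 4: "rcis r4 (\<delta> - 2 * pi) = rcis r4 \<delta>"
      using rcis_plus_2pi[of r4 "\<delta> - 2 * pi"] by simp
    have "(- a) \<bullet> rcis r4 (\<delta> - 2 * pi) > - b \<or> (- a) \<bullet> rcis r2 \<beta> > - b"
      by (rule boundary_points_not_separated[OF K, of _ \<alpha> _ \<gamma> _ r1 _ r3])
         (use angles r x ab False in \<open>auto simp: 4\<close>)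
    then have "a \<bullet> rcis r4 \<delta> < b \<or> a \<bullet> rcis r2 \<beta> < b" by (simp add: 4)
    with ab(2) show False by (meson ends_in_segment less_asym)
  qed
qed

text \<open>The points are numbered by angle around an interior point. Angles are distinct because,
  of two boundary points on one ray, the nearer one would be interior.\<close>

lemma convex_body_boundary_order:
  fixes K X :: "complex set"
  assumes "convex_body K" "X \<subseteq> frontier K" "finite X"
  obtains x where "bij_betw x {..<card X} X"
    "\<And>p q r s. p < q \<Longrightarrow> q < r \<Longrightarrow> r < s \<Longrightarrow> s < card X \<Longrightarrow>
       closed_segment (x p) (x r) \<inter> closed_segment (x q) (x s) \<noteq> {}"
proof -
  from assms(1) obtain z where K: "convex K" and z: "z \<in> interior K"
    unfolding convex_body_def by blast
  define K' where "K' = (+) (- z) ` K"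
  have K': "convex K'" "0 \<in> interior K'"
    using K z by (auto simp: K'_def convex_translation interior_translation simp del: uminus_add_conv_diff
        intro!: image_eqI[of _ _ z])
  have X: "w - z \<in> closure K' - interior K'" if "w \<in> X" for w
    using that assms(2) by (auto simp: K'_def frontier_def interior_translation closure_translation
        simp del: uminus_add_conv_diff intro!: image_eqI[of _ _ w])
  define g where "g w = Arg (w - z)" for w
  have nz: "cmod (w - z) > 0" if "w \<in> X" for w
    using X[OF that] K'(2) by auto
  have polar: "w - z = rcis (cmod (w - z)) (g w)" for w
    by (simp add: g_def rcis_cmod_Arg)
  have "v = w" if vw: "v \<in> X" "w \<in> X" "g v = g w" "cmod (v - z) \<le> cmod (w - z)" for v w
  proof (rule ccontr)
    assume "v \<noteq> w"
    have "v - z = (cmod (v - z) / cmod (w - z)) *\<^sub>R (w - z)"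
      using nz[OF vw(2)] by (subst (1 3) polar) (simp add: vw(3) rcis_def scaleR_conv_of_real)
    moreover have "cmod (v - z) \<noteq> cmod (w - z)"
      using \<open>v \<noteq> w\<close> polar[of v] polar[of w] vw(3) by (metis diff_add_cancel)
    ultimately have "v - z \<in> open_segment 0 (w - z)"
      using vw nz[OF vw(2)] nz[OF vw(1)]
      by (auto simp: in_segment intro!: exI[of _ "cmod (v - z) / cmod (w - z)"])
    then show False
      using in_interior_closure_convex_segment[OF K', of "w - z"] X vw by auto
  qed
  then have inj: "inj_on g X" by (intro inj_onI) (metis nle_le)
  define l where "l = sorted_list_of_set (g ` X)"
  have l: "set l = g ` X" "length l = card X" "distinct l" "sorted_wrt (<) l"
    using assms(3) inj by (simp_all add: l_def card_image)
  define x where "x p = inv_into X g (l ! p)" for p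
  have "bij_betw ((!) l) {..<card X} (g ` X)"
    using l by (intro bij_betw_nth) auto
  moreover have "bij_betw (inv_into X g) (g ` X) X"
    using inj by (intro bij_betw_inv_into) (simp add: bij_betw_def)
  ultimately have bij: "bij_betw x {..<card X} X"
    unfolding x_def using bij_betw_trans[of "(!) l" "{..<card X}" "g ` X" "inv_into X g" X]
    by (simp add: comp_def)
  have xX: "x p \<in> X" if "p < card X" for p
    using bij that by (auto simp: bij_betw_def)
  have gx: "g (x p) = l ! p" if "p < card X" for p
    unfolding x_def using that l by (intro f_inv_into_f) (metis nth_mem)
  have mono: "g (x p) < g (x q)" if "p < q" "q < card X" for p q
    using that l gx[of p] gx[of q] sorted_wrt_nth_less[of "(<)" l p q] by auto
  show ?thesis
  proof (rule that[OF bij])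
    fix p q r s assume pqrs: "p < q" "q < r" "r < s" "s < card X"
    then have inX: "x p \<in> X" "x q \<in> X" "x r \<in> X" "x s \<in> X" by (auto intro!: xX)
    have "- pi < g (x p)" "g (x s) \<le> pi" unfolding g_def using Arg_bounded by auto
    then have "g (x s) < g (x p) + 2 * pi" by linarith
    then have "closed_segment (rcis (cmod (x p - z)) (g (x p))) (rcis (cmod (x r - z)) (g (x r))) \<inter>
          closed_segment (rcis (cmod (x q - z)) (g (x q))) (rcis (cmod (x s - z)) (g (x s))) \<noteq> {}"
      using pqrs nz inX X by (intro diagonals_meet[OF K'] mono) (auto simp flip: polar)
    then obtain w where "w \<in> closed_segment (x p - z) (x r - z)" "w \<in> closed_segment (x q - z) (x s - z)"
      by (auto simp flip: polar)
    then have "z + w \<in> closed_segment (x p) (x r) \<inter> closed_segment (x q) (x s)"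
      using closed_segment_translation_eq[of z w "x p - z" "x r - z"]
        closed_segment_translation_eq[of z w "x q - z" "x s - z"] by simp
    then show "closed_segment (x p) (x r) \<inter> closed_segment (x q) (x s) \<noteq> {}" by blast
  qed
qed

section \<open>Triangulations of the plane\<close>

text \<open>Running over two-element subsets keeps a triangle a mere set of vertices, with no order
  of its corners to choose.\<close>

definition triangle_curve :: "('v set \<Rightarrow> real \<Rightarrow> complex) \<Rightarrow> 'v set \<Rightarrow> complex set" where
  "triangle_curve crv t = (\<Union>e\<in>{e. e \<subseteq> t \<and> card e = 2}. path_image (crv e))"

definition facial ::
    "'v set \<Rightarrow> 'v set set \<Rightarrow> ('v \<Rightarrow> complex) \<Rightarrow> ('v set \<Rightarrow> real \<Rightarrow> complex) \<Rightarrow>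
     complex set \<Rightarrow> 'v set \<Rightarrow> bool" where
  "facial U E pos crv G t \<longleftrightarrow> G \<in> faces U E pos crv \<and> card t = 3 \<and>
     (\<forall>e. e \<subseteq> t \<and> card e = 2 \<longrightarrow> e \<in> E) \<and> frontier G = triangle_curve crv t"

lemma card2_subsets_of_triple:
  assumes "a \<noteq> b" "b \<noteq> c" "a \<noteq> c"
  shows "{e. e \<subseteq> {a, b, c} \<and> card e = 2} = {{a, b}, {b, c}, {a, c}}"
proof -
  have "e \<in> {{a, b}, {b, c}, {a, c}}" if e: "e \<subseteq> {a, b, c}" "card e = 2" for e
  proof -
    obtain x y where "e = {x, y}" "x \<noteq> y" using e(2) by (auto simp: card_2_iff)
    with e show ?thesis by auto
  qed
  with assms show ?thesis by (auto simp: card_insert_if)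
qed

lemma facial_triple:
  assumes "plane_triangulation U E pos crv" "G \<in> faces U E pos crv"
  obtains t where "facial U E pos crv G t"
proof -
  from assms obtain a b c where abc: "a \<noteq> b" "b \<noteq> c" "a \<noteq> c" "{a, b} \<in> E" "{b, c} \<in> E" "{a, c} \<in> E"
    "frontier G = path_image (crv {a, b}) \<union> path_image (crv {b, c}) \<union> path_image (crv {a, c})"
    unfolding plane_triangulation_def by blast
  have 2: "e \<subseteq> {a, b, c} \<and> card e = 2 \<longleftrightarrow> e \<in> {{a, b}, {b, c}, {a, c}}" for e
    using card2_subsets_of_triple[OF abc(1-3)] by blast
  have "facial U E pos crv G {a, b, c}"
    unfolding facial_def triangle_curve_def 2 using abc assms(2) by auto
  then show ?thesis by (rule that)
qed

section \<open>Jordan curves and arcs\<close>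

lemma Jordan_two_sides:
  fixes C :: "complex set"
  assumes "simple_path g" "pathfinish g = pathstart g" "path_image g = C"
    and F: "F \<in> components (- M)" "C \<subseteq> M" "frontier F = C"
  obtains R where "open R" "connected R" "R \<inter> F = {}" "R \<union> F = - C" "frontier R = C" "R \<noteq> {}"
proof -
  have J: "inside C \<noteq> {}" "open (inside C)" "connected (inside C)" "outside C \<noteq> {}" "open (outside C)"
    "connected (outside C)" "inside C \<inter> outside C = {}" "inside C \<union> outside C = - C"
    "frontier (inside C) = C" "frontier (outside C) = C"
    using Jordan_inside_outside[OF assms(1,2)] assms(3) by auto
  have F': "F \<noteq> {}" "connected F" "F \<inter> C = {}"
    using F in_components_nonempty in_components_connected in_components_subset by blast+
  \<comment> \<open>Connected sets that meet, avoid \<open>C\<close> and both have frontier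
    \<open>C\<close> coincide, since neither can leave the other without crossing \<open>C\<close>.
    So \<open>F\<close> is one of the two Jordan regions, bounded or not, and \<open>R\<close> is
    the other.\<close>
  have eq: "F = D" if D: "connected D" "D \<inter> C = {}" "D \<inter> F \<noteq> {}" "frontier D = C" for D
  proof -
    have "D - F = {}" using connected_Int_frontier[OF D(1,3)] D(2) F(3) by blast
    moreover have "F - D = {}" using connected_Int_frontier[OF F'(2), of D] D(3,4) F'(3) by blast
    ultimately show ?thesis by blast
  qed
  have "F = inside C \<or> F = outside C"
  proof (cases "inside C \<inter> F = {}")
    case True
    then have "outside C \<inter> F \<noteq> {}" using J F' by blast
    with eq[of "outside C"] J show ?thesis by blast
  next
    case False
    with eq[of "inside C"] J show ?thesis by blast
  qed
  then show ?thesis using J that[of "inside C"] that[of "outside C"] by blast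
qed

lemma arc_oriented:
  assumes "arc g" "{pathstart g, pathfinish g} = {x, y}"
  obtains h where "arc h" "path_image h = path_image g" "pathstart h = x" "pathfinish h = y"
proof (cases "pathstart g = x")
  case True
  moreover have "pathfinish g = y"
    using assms arc_distinct_ends[OF assms(1)] True by (metis doubleton_eq_iff)
  ultimately show ?thesis using that assms by blast
next
  case False
  then have "pathstart g = y" "pathfinish g = x" using assms(2) by (metis doubleton_eq_iff)+
  with that[of "reversepath g"] assms(1) show ?thesis by (simp add: arc_reversepath)
qed

text \<open>The inverse of the arc would map a nonempty open set of the plane continuously and
  injectively into the line, against invariance of dimension. It provides points near an edge that
  are not on it.\<close>

lemma arc_empty_interior:
  fixes g :: "real \<Rightarrow> complex"
  assumes "arc g"
  shows "interior (path_image g) = {}"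
proof (rule ccontr)
  assume ne: "interior (path_image g) \<noteq> {}"
  obtain h where h: "homeomorphism {0..1} (path_image g) g h"
    using assms homeomorphism_arc by (metis path_image_def homeomorphism_def)
  then have "continuous_on (path_image g) h" "inj_on h (path_image g)"
    by (auto simp: homeomorphism_def intro: inj_on_inverseI)
  then have "continuous_on (interior (path_image g)) h" "inj_on h (interior (path_image g))"
    by (meson continuous_on_subset interior_subset inj_on_subset)+
  then show False
    using invariance_of_dimension[of "interior (path_image g)" h] ne by simp
qed

lemma plane_graphD:
  assumes "plane_graph U E pos crv"
  shows "finite U" "finite E" "inj_on pos U"
    and "\<And>e. e \<in> E \<Longrightarrow> e \<subseteq> U \<and> card e = 2"
    and "\<And>e. e \<in> E \<Longrightarrow> arc (crv e)"
    and "\<And>e. e \<in> E \<Longrightarrow> {pathstart (crv e), pathfinish (crv e)} = pos ` e"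
    and "\<And>e. e \<in> E \<Longrightarrow> path_image (crv e) \<inter> pos ` U = pos ` e"
    and "\<And>e f. e \<in> E \<Longrightarrow> f \<in> E \<Longrightarrow> e \<noteq> f \<Longrightarrow> path_image (crv e) \<inter> path_image (crv f) = pos ` (e \<inter> f)"
proof -
  have "E \<subseteq> Pow U" "finite U" using assms by (auto simp: plane_graph_def simple_graph_def)
  then show "finite U" "finite E" by (auto intro: finite_subset)
qed (use assms in \<open>auto simp: plane_graph_def simple_graph_def\<close>)

lemma triangle_curve_simple_loop:
  assumes pg: "plane_graph U E pos crv"
    and t: "card t = 3" "\<And>e. e \<subseteq> t \<Longrightarrow> card e = 2 \<Longrightarrow> e \<in> E"
  obtains g where "simple_path g" "pathfinish g = pathstart g" "path_image g = triangle_curve crv t"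
proof -
  note pg = plane_graphD[OF pg]
  obtain a b c where abc: "t = {a, b, c}" "a \<noteq> b" "b \<noteq> c" "a \<noteq> c"
    using t(1) by (auto simp: card_3_iff)
  have E: "{a, b} \<in> E" "{b, c} \<in> E" "{a, c} \<in> E" using abc by (auto intro!: t(2))
  have inj: "pos a \<noteq> pos b" "pos b \<noteq> pos c" "pos a \<noteq> pos c"
    using pg(4)[OF E(1)] pg(4)[OF E(2)] pg(3) abc by (auto dest: inj_onD)
  obtain g1 where g1: "arc g1" "path_image g1 = path_image (crv {a, b})" "pathstart g1 = pos a" "pathfinish g1 = pos b"
    using arc_oriented[OF pg(5)[OF E(1)]] pg(6)[OF E(1)] by auto
  obtain g2 where g2: "arc g2" "path_image g2 = path_image (crv {b, c})" "pathstart g2 = pos b" "pathfinish g2 = pos c"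
    using arc_oriented[OF pg(5)[OF E(2)]] pg(6)[OF E(2)] by auto
  obtain g3 where g3: "arc g3" "path_image g3 = path_image (crv {a, c})" "pathstart g3 = pos c" "pathfinish g3 = pos a"
    using arc_oriented[OF pg(5)[OF E(3)], of "pos c" "pos a"] pg(6)[OF E(3)] by auto
  have I: "path_image g1 \<inter> path_image g2 = {pos b}" "path_image g1 \<inter> path_image g3 = {pos a}"
    "path_image g2 \<inter> path_image g3 = {pos c}"
    using pg(8)[OF E(1,2)] pg(8)[OF E(1,3)] pg(8)[OF E(2,3)] abc
    by (auto simp: g1 g2 g3 doubleton_eq_iff)
  have 12: "arc (g1 +++ g2)" by (rule arc_join) (use g1 g2 I in auto)
  have im: "path_image (g1 +++ g2) = path_image g1 \<union> path_image g2"
    using g1 g2 by (simp add: path_image_join)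
  have "simple_path ((g1 +++ g2) +++ g3)"
    by (rule simple_path_join_loop) (use 12 g1 g2 g3 I im in auto)
  moreover have "path_image ((g1 +++ g2) +++ g3) = triangle_curve crv t"
    unfolding triangle_curve_def abc(1) card2_subsets_of_triple[OF abc(2-4)]
    using im g1 g2 g3 by (auto simp: path_image_join)
  ultimately show ?thesis using that g1 g3 by simp
qed

text \<open>The vertex set of the cell (vertex, open edge or face) of a triangulation that contains the
  point \<open>y\<close>.\<close>

definition carrier_at ::
    "'v set \<Rightarrow> 'v set set \<Rightarrow> ('v \<Rightarrow> complex) \<Rightarrow> ('v set \<Rightarrow> real \<Rightarrow> complex) \<Rightarrow>
     complex \<Rightarrow> 'v set \<Rightarrow> bool" where
  "carrier_at U E pos crv y s \<longleftrightarrow>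
     (\<exists>v\<in>U. y = pos v \<and> s = {v}) \<or>
     (s \<in> E \<and> y \<in> path_image (crv s) \<and> y \<notin> pos ` U) \<or>
     (\<exists>G. y \<in> G \<and> facial U E pos crv G s)"

section \<open>Cells of a plane triangulation and their vertex sets\<close>

locale triangulated_plane =
  fixes U :: "'v set" and E :: "'v set set"
    and pos :: "'v \<Rightarrow> complex" and crv :: "'v set \<Rightarrow> real \<Rightarrow> complex"
  assumes triangulation: "plane_triangulation U E pos crv"
begin

abbreviation M where "M \<equiv> plane_image U E pos crv"
abbreviation fc where "fc \<equiv> facial U E pos crv"
abbreviation car where "car \<equiv> carrier_at U E pos crv"

lemma plane: "plane_graph U E pos crv"
  using triangulation by (simp add: plane_triangulation_def)

lemmas pg = plane_graphD[OF plane]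

lemma compact_M: "compact M"
proof -
  have "compact (path_image (crv e))" if "e \<in> E" for e
    using pg(5)[OF that] by (simp add: arc_imp_path compact_path_image)
  then show ?thesis
    unfolding plane_image_def using pg(1,2)
    by (intro compact_Un compact_UN finite_imp_compact[OF finite_imageI]) auto
qed

lemma facialD:
  assumes "fc G t"
  shows "open G" "connected G" "G \<noteq> {}" "G \<inter> M = {}" "card t = 3" "t \<subseteq> U"
    and "\<And>e. e \<subseteq> t \<Longrightarrow> card e = 2 \<Longrightarrow> e \<in> E"
    and "frontier G = triangle_curve crv t" "G \<in> components (- M)"
proof -
  show G: "G \<in> components (- M)" using assms by (simp add: facial_def faces_def)
  then show "open G" using open_components[of "- M" G] compact_M by (simp add: compact_imp_closed open_Compl)
  show "connected G" "G \<noteq> {}" "G \<inter> M = {}"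
    using in_components_connected[OF G] in_components_nonempty[OF G] in_components_subset[OF G] by auto
  show t: "card t = 3" "\<And>e. e \<subseteq> t \<Longrightarrow> card e = 2 \<Longrightarrow> e \<in> E" "frontier G = triangle_curve crv t"
    using assms by (auto simp: facial_def)
  obtain a b c where abc: "t = {a, b, c}" "a \<noteq> b" "b \<noteq> c" "a \<noteq> c"
    using t(1) by (auto simp: card_3_iff)
  then have "{a, b} \<in> E" "{b, c} \<in> E" by (auto intro!: t(2))
  then show "t \<subseteq> U" using pg(4) abc(1) by blast
qed

lemma curve_subset_M:
  assumes "\<And>e. e \<subseteq> t \<Longrightarrow> card e = 2 \<Longrightarrow> e \<in> E"
  shows "triangle_curve crv t \<subseteq> M"
  unfolding triangle_curve_def plane_image_def using assms by blast

lemma pos_in_curve_iff: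
  assumes "card t = 3" "\<And>e. e \<subseteq> t \<Longrightarrow> card e = 2 \<Longrightarrow> e \<in> E" "v \<in> U"
  shows "pos v \<in> triangle_curve crv t \<longleftrightarrow> v \<in> t"
proof
  assume "pos v \<in> triangle_curve crv t"
  then obtain e where e: "e \<subseteq> t" "card e = 2" "pos v \<in> path_image (crv e)"
    unfolding triangle_curve_def by blast
  then have "pos v \<in> pos ` e" using pg(7)[of e] assms by blast
  with e assms show "v \<in> t" using pg(3,4) by (metis assms(2,3) inj_on_image_mem_iff subsetD)
next
  assume "v \<in> t"
  obtain w where w: "w \<in> t" "w \<noteq> v" using assms(1) \<open>v \<in> t\<close>
    by (metis card_3_iff insertCI)
  then have vw: "{v, w} \<subseteq> t" "card {v, w} = 2" using \<open>v \<in> t\<close> by auto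
  then have "pos v \<in> path_image (crv {v, w})" using pg(7)[OF assms(2)[OF vw]] by blast
  then show "pos v \<in> triangle_curve crv t" unfolding triangle_curve_def using vw by blast
qed

lemma edge_point_in_curve:
  assumes "\<And>e. e \<subseteq> t \<Longrightarrow> card e = 2 \<Longrightarrow> e \<in> E"
    and "e \<in> E" "y \<in> path_image (crv e)" "y \<notin> pos ` U" "y \<in> triangle_curve crv t"
  shows "e \<subseteq> t"
proof -
  obtain f where f: "f \<subseteq> t" "card f = 2" "y \<in> path_image (crv f)"
    using assms(5) unfolding triangle_curve_def by blast
  have "f = e"
  proof (rule ccontr)
    assume "f \<noteq> e"
    then have "y \<in> pos ` (f \<inter> e)" using pg(8)[of f e] f assms by blast
    then show False using assms(2,4) pg(4) by blast
  qed
  with f show ?thesis by simp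
qed

lemma carrier_exists: "\<exists>s. car y s"
proof (cases "y \<in> M")
  case True
  then show ?thesis unfolding plane_image_def carrier_at_def by blast
next
  case False
  define G where "G = connected_component_set (- M) y"
  have "G \<in> components (- M)" "y \<in> G"
    using False by (auto simp: G_def components_def)
  then obtain t where "fc G t" using facial_triple[OF triangulation, of G] by (auto simp: faces_def)
  then show ?thesis using \<open>y \<in> G\<close> unfolding carrier_at_def by blast
qed

lemma carrier_cases:
  assumes "car y s"
  obtains (vertex) v where "v \<in> U" "y = pos v" "s = {v}" "y \<in> M"
  | (edge) "s \<in> E" "y \<in> path_image (crv s)" "y \<notin> pos ` U" "y \<in> M"
  | (face) G where "fc G s" "y \<in> G" "y \<notin> M"
proof -
  consider v where "v \<in> U" "y = pos v" "s = {v}"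
    | "s \<in> E" "y \<in> path_image (crv s)" "y \<notin> pos ` U"
    | G where "fc G s" "y \<in> G"
    using assms unfolding carrier_at_def by blast
  then show ?thesis
  proof cases
    case 3
    then have "y \<notin> M" using facialD(4) by blast
    with 3 show ?thesis using face by blast
  qed (use vertex edge in \<open>auto simp: plane_image_def\<close>)
qed

lemma faces_eq:
  assumes "fc G s" "fc G' s'" "y \<in> G" "y \<in> G'"
  shows "G = G'"
  using components_nonoverlap[OF facialD(9)[OF assms(1)] facialD(9)[OF assms(2)]] assms by blast

lemma facial_unique:
  assumes "fc G s" "fc G s'"
  shows "s = s'"
proof -
  have "v \<in> s \<longleftrightarrow> v \<in> s'" if "v \<in> U" for v
    using pos_in_curve_iff[OF facialD(5,7)[OF assms(1)] that]
      pos_in_curve_iff[OF facialD(5,7)[OF assms(2)] that] facialD(8)[OF assms(1)] facialD(8)[OF assms(2)]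
    by simp
  then show ?thesis using facialD(6)[OF assms(1)] facialD(6)[OF assms(2)] by blast
qed

lemma carrier_unique:
  assumes "car y s" "car y s'"
  shows "s = s'"
  using assms(1)
proof (cases rule: carrier_cases)
  case (vertex v)
  from assms(2) vertex show ?thesis
    by (cases rule: carrier_cases) (use pg(3) in \<open>auto dest: inj_onD\<close>)
next
  case edge
  from assms(2) show ?thesis
  proof (cases rule: carrier_cases)
    case edge': edge
    show ?thesis
    proof (rule ccontr)
      assume "s \<noteq> s'"
      then have "y \<in> pos ` (s \<inter> s')" using edge edge' pg(8) by blast
      then show False using edge edge' pg(4) by blast
    qed
  qed (use edge in auto)
next
  case (face G)
  from assms(2) show ?thesis
  proof (cases rule: carrier_cases)
    case (face G')
    with \<open>y \<in> G\<close> \<open>fc G s\<close> show ?thesis using faces_eq facial_unique by blast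
  qed (use face in auto)
qed

lemma carrier_clique:
  assumes "car y s"
  shows "s \<subseteq> U" "s \<noteq> {}" "\<And>u v. u \<in> s \<Longrightarrow> v \<in> s \<Longrightarrow> u \<noteq> v \<Longrightarrow> {u, v} \<in> E" "card s \<le> 3"
    "card s = 3 \<Longrightarrow> \<exists>G. fc G s \<and> y \<in> G"
proof -
  have "s \<subseteq> U \<and> s \<noteq> {} \<and> (\<forall>u\<in>s. \<forall>v\<in>s. u \<noteq> v \<longrightarrow> {u, v} \<in> E) \<and> card s \<le> 3
    \<and> (card s = 3 \<longrightarrow> (\<exists>G. fc G s \<and> y \<in> G))"
    using assms
  proof (cases rule: carrier_cases)
    case edge
    then have "s \<subseteq> U" "card s = 2" using pg(4) by auto
    then obtain a b where "s = {a, b}" by (auto simp: card_2_iff)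
    then show ?thesis using edge \<open>s \<subseteq> U\<close> \<open>card s = 2\<close> by (auto simp: insert_commute)
  next
    case (face G)
    then show ?thesis using facialD(5,6,7)[OF face(1)] by auto
  qed auto
  then show "s \<subseteq> U" "s \<noteq> {}" "\<And>u v. u \<in> s \<Longrightarrow> v \<in> s \<Longrightarrow> u \<noteq> v \<Longrightarrow> {u, v} \<in> E" "card s \<le> 3"
    "card s = 3 \<Longrightarrow> \<exists>G. fc G s \<and> y \<in> G" by auto
qed

text \<open>Carriers can only grow nearby. Inside a face this is openness. If \<open>x\<close> lies
  on the graph, a small ball avoids all other vertices and all edges that miss \<open>x\<close>; a
  point of a face in this ball is joined to \<open>x\<close> by a segment that hits the frontier of
  the face, and the carrier there contains \<open>s\<close> and is contained in the triple of the
  face.\<close>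

lemma carrier_lower_semicontinuous:
  assumes "car x s"
  obtains r where "r > 0" "\<And>y s'. y \<in> ball x r \<Longrightarrow> car y s' \<Longrightarrow> s \<subseteq> s'"
proof (cases "x \<in> M")
  case False
  with assms obtain G where G: "fc G s" "x \<in> G" by (cases rule: carrier_cases) auto
  then obtain r where r: "r > 0" "ball x r \<subseteq> G" using facialD(1) open_contains_ball by metis
  have "s \<subseteq> s'" if "y \<in> ball x r" "car y s'" for y s'
  proof -
    have "car y s" using that(1) r(2) G(1) unfolding carrier_at_def by blast
    with carrier_unique that(2) show ?thesis by blast
  qed
  with r that show ?thesis by blast
next
  case True
  define B where "B = pos ` {v \<in> U. pos v \<noteq> x} \<union> (\<Union>e\<in>{e \<in> E. x \<notin> path_image (crv e)}. path_image (crv e))"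
  have "closed (path_image (crv e))" if "e \<in> E" for e
    using pg(5)[OF that] by (simp add: arc_imp_path closed_path_image)
  then have "closed B"
    unfolding B_def using pg(1,2)
    by (intro closed_Un closed_UN finite_imp_closed[OF finite_imageI]) auto
  moreover have "x \<in> - B" unfolding B_def by blast
  ultimately obtain r where r: "r > 0" "ball x r \<inter> B = {}"
    by (metis open_Compl open_contains_ball disjoint_eq_subset_Compl)
  have on_M: "s \<subseteq> s'" if z: "z \<in> ball x r" "z \<in> M" "car z s'" for z s'
    using z(3)
  proof (cases rule: carrier_cases)
    case (vertex v)
    then have "x = z" using r z(1) unfolding B_def by blast
    with carrier_unique assms z(3) show ?thesis by blast
  next
    case edge
    then have x: "x \<in> path_image (crv s')" using r z(1) unfolding B_def by blast
    show ?thesis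
    proof (cases "x \<in> pos ` U")
      case True
      then obtain v where v: "v \<in> U" "x = pos v" by blast
      then have "s = {v}" using carrier_unique[OF assms, of "{v}"] by (auto simp: carrier_at_def)
      moreover have "pos v \<in> pos ` s'" using pg(7)[OF edge(1)] v x by blast
      then have "v \<in> s'" using pg(3) pg(4)[OF edge(1)] v by (metis inj_on_image_mem_iff)
      ultimately show ?thesis by simp
    next
      case False
      then show ?thesis using carrier_unique[OF assms, of s'] x edge(1) by (auto simp: carrier_at_def)
    qed
  qed (use z in auto)
  have "s \<subseteq> s'" if y: "y \<in> ball x r" "car y s'" for y s'
  proof (cases "y \<in> M")
    case False
    then obtain G where G: "fc G s'" "y \<in> G" by (cases rule: carrier_cases[OF y(2)]) auto
    have "closed_segment y x \<inter> frontier G \<noteq> {}"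
      by (rule connected_Int_frontier) (use G facialD(4)[OF G(1)] True in auto)
    then obtain z where z: "z \<in> closed_segment y x" "z \<in> triangle_curve crv s'"
      using facialD(8)[OF G(1)] by blast
    have "closed_segment y x \<subseteq> ball x r" using y(1) r(1) by (intro closed_segment_subset) auto
    then have zB: "z \<in> ball x r" using z by blast
    have zM: "z \<in> M" using z(2) curve_subset_M facialD(7)[OF G(1)] by blast
    obtain s'' where s'': "car z s''" using carrier_exists by blast
    then have "s \<subseteq> s''" using on_M zB zM by blast
    moreover have "s'' \<subseteq> s'"
      using s''
    proof (cases rule: carrier_cases)
      case (vertex v)
      then show ?thesis using pos_in_curve_iff[OF facialD(5,7)[OF G(1)]] z by auto
    next
      case edge
      then show ?thesis using edge_point_in_curve facialD(7)[OF G(1)] z by blast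
    qed (use zM in auto)
    ultimately show ?thesis by blast
  qed (use on_M y in blast)
  with r(1) show ?thesis by (rule that)
qed

text \<open>The cells with all vertices in \<open>t\<close> are corners and sides of the triangle,
  which lie on the curve, and faces with triple \<open>t\<close>. Such a face meeting
  \<open>R\<close> would have the curve as its frontier and swallow \<open>R\<close>, but
  \<open>R\<close> contains a fourth vertex.\<close>

lemma other_side:
  assumes card_U: "card U \<ge> 4" and "fc F t"
  obtains R where "open R" "connected R" "R \<inter> F = {}" "R \<union> F = - triangle_curve crv t"
    "frontier R = triangle_curve crv t" "R \<noteq> {}"
    "\<And>y s. y \<in> R \<Longrightarrow> car y s \<Longrightarrow> \<not> s \<subseteq> t"
proof -
  note F = facialD[OF assms(2)]
  obtain g where g: "simple_path g" "pathfinish g = pathstart g" "path_image g = triangle_curve crv t"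
    using triangle_curve_simple_loop[OF plane F(5,7)] by blast
  obtain R where R: "open R" "connected R" "R \<inter> F = {}" "R \<union> F = - triangle_curve crv t"
    "frontier R = triangle_curve crv t" "R \<noteq> {}"
    using Jordan_two_sides[OF g F(9) curve_subset_M F(8)] F(7) by blast
  have "\<not> s \<subseteq> t" if y: "y \<in> R" "car y s" for y s
  proof
    assume st: "s \<subseteq> t"
    have yC: "y \<notin> triangle_curve crv t" using y(1) R(4) by blast
    from y(2) show False
    proof (cases rule: carrier_cases)
      case (vertex v)
      then show False using pos_in_curve_iff[OF F(5,7)] st yC by auto
    next
      case edge
      then have "card s = 2" using pg(4) by blast
      with edge st yC show False unfolding triangle_curve_def by blast
    next
      case (face G)
      have "finite t" using F(5) by (metis card.infinite zero_neq_numeral)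
      then have "s = t" using st F(5) facialD(5)[OF face(1)] by (simp add: card_subset_eq)
      then have frG: "frontier G = triangle_curve crv t" using facialD(8)[OF face(1)] by simp
      then have GC: "G \<inter> triangle_curve crv t = {}" "R \<inter> triangle_curve crv t = {}"
        using facialD(1)[OF face(1)] R(4) by (auto simp: frontier_def interior_open)
      have "R - G = {}" using connected_Int_frontier[OF R(2), of G] y(1) face(2) frG GC by blast
      obtain v where v: "v \<in> U" "v \<notin> t"
      proof -
        have "U \<noteq> t" using card_U F(5) by auto
        with F(6) that show ?thesis by blast
      qed
      then have "pos v \<notin> triangle_curve crv t" using pos_in_curve_iff[OF F(5,7)] by blast
      moreover have "pos v \<in> M" using v by (auto simp: plane_image_def)
      ultimately have "pos v \<in> R" using R(4) F(4) by blast
      then show False using \<open>R - G = {}\<close> facialD(4)[OF face(1)] \<open>pos v \<in> M\<close> by blast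
    qed
  qed
  with R show ?thesis by (rule that)
qed

text \<open>Near an inner point of the edge all carriers contain \<open>e\<close>. A nearby point
  off the edge gives the facial triangle \<open>t\<close>. The edge is also in the frontier of the
  other side of \<open>t\<close>, and a nearby point there has a carrier not contained in
  \<open>t\<close>, which gives the second triangle.\<close>

lemma edge_on_two_facial_triangles:
  assumes card_U: "card U \<ge> 4" and e: "e \<in> E"
  obtains t t' G G' where "fc G t" "fc G' t'" "t \<noteq> t'" "e \<subseteq> t" "e \<subseteq> t'"
proof -
  have arc: "arc (crv e)" and e2: "card e = 2" using pg(4,5)[OF e] by auto
  define x where "x = crv e (1/2)"
  have x: "x \<in> path_image (crv e)" by (auto simp: x_def path_image_def)
  have "x \<noteq> pathstart (crv e)" "x \<noteq> pathfinish (crv e)"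
    using arc inj_onD[of "crv e" "{0..1}" "1/2" 0] inj_onD[of "crv e" "{0..1}" "1/2" 1]
    by (auto simp: x_def arc_def pathstart_def pathfinish_def)
  then have "x \<notin> pos ` e" using pg(6)[OF e] by blast
  then have xU: "x \<notin> pos ` U" using pg(7)[OF e] x by blast
  then have car: "car x e" using x e by (simp add: carrier_at_def)
  then obtain r where r: "r > 0" "\<And>y s'. y \<in> ball x r \<Longrightarrow> car y s' \<Longrightarrow> e \<subseteq> s'"
    using carrier_lower_semicontinuous by metis
  have big: "\<exists>G. fc G s'" if "car y s'" "e \<subseteq> s'" "e \<noteq> s'" for y s'
  proof -
    have "finite s'" using carrier_clique(1)[OF that(1)] pg(1) finite_subset by blast
    then have "card e < card s'" using that by (intro psubset_card_mono) auto
    then show ?thesis using carrier_clique(4,5)[OF that(1)] e2 by auto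
  qed
  have "\<not> ball x r \<subseteq> path_image (crv e)"
    using arc_empty_interior[OF arc] r(1) interior_maximal[OF _ open_ball]
    by (metis centre_in_ball empty_iff subsetD)
  then obtain y where y: "y \<in> ball x r" "y \<notin> path_image (crv e)" by blast
  obtain t where t: "car y t" using carrier_exists by blast
  have "t \<noteq> e"
  proof
    assume "t = e"
    with t have "car y e" by simp
    then show False
      by (cases rule: carrier_cases) (use y e2 facialD(5) in \<open>fastforce+\<close>)
  qed
  then obtain G where G: "fc G t" "e \<subseteq> t" using big t r(2) y(1) by metis
  obtain R where R: "open R" "connected R" "R \<inter> G = {}" "R \<union> G = - triangle_curve crv t"
    "frontier R = triangle_curve crv t" "R \<noteq> {}"
    "\<And>y s. y \<in> R \<Longrightarrow> car y s \<Longrightarrow> \<not> s \<subseteq> t"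
    using other_side[OF card_U G(1)] by blast
  have "x \<in> closure R" using x G(2) e2 R(5) unfolding triangle_curve_def frontier_def by blast
  then obtain y' where y': "y' \<in> R" "y' \<in> ball x r"
    using r(1) by (metis closure_approachable dist_commute mem_ball)
  obtain t' where t': "car y' t'" using carrier_exists by blast
  then have "e \<subseteq> t'" "\<not> t' \<subseteq> t" using r(2) R(7) y' by blast+
  then have "e \<noteq> t'" using G(2) by blast
  then obtain G' where "fc G' t'" using big[OF t' \<open>e \<subseteq> t'\<close>] by blast
  then show ?thesis by (rule that[OF G(1)]) (use G \<open>e \<subseteq> t'\<close> \<open>\<not> t' \<subseteq> t\<close> in auto)
qed

text \<open>If two sets of vertices without edges between them covered the vertices off a facial
  triangle, the stars of the two sets would disconnect the other side of the triangle.\<close>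

lemma facial_triangle_nonseparating_sets:
  assumes card_U: "card U \<ge> 4" and F: "fc F t" and AB: "A \<union> B = U - t" "A \<inter> B = {}"
    and no_edge: "\<And>a b. a \<in> A \<Longrightarrow> b \<in> B \<Longrightarrow> {a, b} \<notin> E"
  shows "A = {} \<or> B = {}"
proof (rule ccontr)
  assume ne: "\<not> (A = {} \<or> B = {})"
  obtain R where R: "open R" "connected R" "R \<inter> F = {}" "R \<union> F = - triangle_curve crv t"
    "frontier R = triangle_curve crv t" "R \<noteq> {}"
    "\<And>y s. y \<in> R \<Longrightarrow> car y s \<Longrightarrow> \<not> s \<subseteq> t"
    using other_side[OF card_U F] by blast
  \<comment> \<open>The union of the cells having a vertex in \<open>W\<close>. It is open since
    carriers only grow nearby; the stars of \<open>A\<close> and \<open>B\<close> are disjoint since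
    every carrier is a clique.\<close>
  define star where "star W = {y. \<exists>s. car y s \<and> s \<inter> W \<noteq> {}}" for W
  have "open (star W)" for W
    unfolding open_contains_ball
  proof
    fix x assume "x \<in> star W"
    then obtain s where s: "car x s" "s \<inter> W \<noteq> {}" by (auto simp: star_def)
    then obtain r where r: "r > 0" "\<And>y s'. y \<in> ball x r \<Longrightarrow> car y s' \<Longrightarrow> s \<subseteq> s'"
      using carrier_lower_semicontinuous by metis
    have "y \<in> star W" if "y \<in> ball x r" for y
    proof -
      obtain s' where "car y s'" using carrier_exists by blast
      with r(2)[OF that] s(2) show ?thesis unfolding star_def by blast
    qed
    with r(1) show "\<exists>e>0. ball x e \<subseteq> star W" by blast
  qed
  moreover have "R \<subseteq> star A \<union> star B"
  proof
    fix y assume "y \<in> R"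
    obtain s where s: "car y s" using carrier_exists by blast
    then have "\<not> s \<subseteq> t" "s \<subseteq> U" using R(7) \<open>y \<in> R\<close> carrier_clique(1) by blast+
    then have "s \<inter> (A \<union> B) \<noteq> {}" using AB(1) by blast
    with s show "y \<in> star A \<union> star B" unfolding star_def by blast
  qed
  moreover have "star A \<inter> star B = {}"
  proof (rule ccontr)
    assume "star A \<inter> star B \<noteq> {}"
    then obtain y s s' where s: "car y s" "s \<inter> A \<noteq> {}" "car y s'" "s' \<inter> B \<noteq> {}"
      unfolding star_def by blast
    then have "s = s'" using carrier_unique by blast
    with s obtain a b where "a \<in> s" "b \<in> s" "a \<in> A" "b \<in> B" by blast
    with s no_edge AB(2) carrier_clique(3)[OF s(1)] show False by blast
  qed
  moreover have "star W \<inter> R \<noteq> {}" if W: "W \<noteq> {}" "W \<subseteq> U - t" for W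
  proof -
    obtain v where v: "v \<in> W" "v \<in> U" "v \<notin> t" using W by blast
    have "car (pos v) {v}" using v by (auto simp: carrier_at_def)
    then have "pos v \<in> star W" using v by (auto simp: star_def)
    moreover have "pos v \<notin> triangle_curve crv t"
      using pos_in_curve_iff[OF facialD(5,7)[OF F]] v by blast
    moreover have "pos v \<in> M" using v by (auto simp: plane_image_def)
    ultimately show ?thesis using R(4) facialD(4)[OF F] by blast
  qed
  moreover have "A \<subseteq> U - t" "B \<subseteq> U - t" using AB(1) by blast+
  ultimately show False
    using connectedD[OF R(2), of "star A" "star B"] ne by blast
qed

lemma outer_component: "outside M \<in> components (- M)"
proof -
  have "bounded M" using compact_M compact_imp_bounded by blast
  then show ?thesis
    unfolding outside_in_components
    by (simp add: connected_outside outside_bounded_nonempty)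
qed

lemma outer_facial: obtains t where "fc (outside M) t"
  using facial_triple[OF triangulation] outer_component by (auto simp: faces_def)

text \<open>Without its starting point the arc is a connected set off the graph, so it stays in the
  unbounded face. Its start is then a limit of that face and lies on its frontier.\<close>

lemma arc_from_outer_face:
  assumes "fc (outside M) t" "v \<in> U"
    and g: "arc g" "pathstart g = pos v" "pathfinish g \<in> outside M" "path_image g \<inter> M \<subseteq> {pos v}"
  shows "v \<in> t"
proof -
  define Q where "Q = g ` {0<..1}"
  have cont: "continuous_on {0..1} g" and inj: "inj_on g {0..1}"
    using g(1) by (auto simp: arc_def path_def)
  have conn: "connected Q"
    unfolding Q_def by (intro connected_continuous_image continuous_on_subset[OF cont]) auto
  have "pos v \<notin> Q"
    using g(2) inj by (force simp: Q_def pathstart_def dest: inj_onD)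
  moreover have "Q \<subseteq> path_image g" unfolding Q_def path_image_def by (intro image_mono) auto
  ultimately have "Q \<subseteq> - M" using g(4) by blast
  moreover have "pathfinish g \<in> Q" by (auto simp: Q_def pathfinish_def)
  ultimately have "Q \<subseteq> outside M"
    using components_maximal[OF outer_component conn] g(3) by blast
  moreover have "pos v \<in> closure Q"
  proof -
    have "g ` closure {0<..1} \<subseteq> closure Q"
      unfolding Q_def by (rule continuous_image_closure_subset[OF cont]) auto
    moreover have "g 0 \<in> g ` closure {0<..1}" by (intro imageI) simp
    ultimately have "g 0 \<in> closure Q" by (rule subsetD)
    then show ?thesis using g(2) by (simp add: pathstart_def)
  qed
  ultimately have "pos v \<in> closure (outside M)" using closure_mono by blast
  moreover have "pos v \<in> M" using assms(2) by (auto simp: plane_image_def)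
  then have "pos v \<notin> interior (outside M)"
    using facialD(4)[OF assms(1)] interior_subset by blast
  ultimately have "pos v \<in> frontier (outside M)" by (simp add: frontier_def)
  then show "v \<in> t"
    using facialD(8)[OF assms(1)] pos_in_curve_iff[OF facialD(5,7)[OF assms(1)] assms(2)] by simp
qed

end

section \<open>Triangles in straight line drawings\<close>

lemma barycentric_coordinates:
  fixes a b c :: complex
  assumes "\<not> collinear {a, b, c}"
  obtains \<alpha> \<beta> \<gamma> :: "complex \<Rightarrow> real" where
    "continuous_on UNIV \<alpha>" "continuous_on UNIV \<beta>" "continuous_on UNIV \<gamma>"
    "\<And>y. \<alpha> y + \<beta> y + \<gamma> y = 1" "\<And>y. y = \<alpha> y *\<^sub>R a + \<beta> y *\<^sub>R b + \<gamma> y *\<^sub>R c"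
    "\<And>u v w. u + v + w = 1 \<Longrightarrow> \<alpha> (u *\<^sub>R a + v *\<^sub>R b + w *\<^sub>R c) = u"
    "\<And>u v w. u + v + w = 1 \<Longrightarrow> \<beta> (u *\<^sub>R a + v *\<^sub>R b + w *\<^sub>R c) = v"
    "\<And>u v w. u + v + w = 1 \<Longrightarrow> \<gamma> (u *\<^sub>R a + v *\<^sub>R b + w *\<^sub>R c) = w"
    "\<And>s t x y. s + t = 1 \<Longrightarrow> \<alpha> (s *\<^sub>R x + t *\<^sub>R y) = s * \<alpha> x + t * \<alpha> y"
    "\<And>s t x y. s + t = 1 \<Longrightarrow> \<beta> (s *\<^sub>R x + t *\<^sub>R y) = s * \<beta> x + t * \<beta> y"
    "\<And>s t x y. s + t = 1 \<Longrightarrow> \<gamma> (s *\<^sub>R x + t *\<^sub>R y) = s * \<gamma> x + t * \<gamma> y"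
proof -
  \<comment> \<open>Twice the signed area of the triangle \<open>p q r\<close>. The barycentric
    coordinates are quotients of such areas, as in Cramer's rule.\<close>
  define orient where "orient p q r = (Re q - Re p) * (Im r - Im p) - (Im q - Im p) * (Re r - Re p)"
    for p q r :: complex
  define D where "D = orient a b c"
  have D: "D \<noteq> 0"
  proof
    assume D0: "D = 0"
    define p q where "p = b - a" and "q = c - a"
    have "p \<noteq> 0" using assms by (auto simp: p_def)
    then have pp: "Re p * Re p + Im p * Im p \<noteq> 0" by (simp add: complex_eq_iff sum_squares_eq_zero_iff)
    have pq: "Re p * Im q = Im p * Re q" using D0 by (simp add: D_def orient_def p_def q_def)
    have "Re q * (Re p * Re p + Im p * Im p) = (Re p * Re q + Im p * Im q) * Re p"
      "Im q * (Re p * Re p + Im p * Im p) = (Re p * Re q + Im p * Im q) * Im p"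
      using pq by algebra+
    \<comment> \<open>The factor is that of the orthogonal projection of \<open>q\<close> to the
      line of \<open>p\<close>; vanishing area makes \<open>q\<close> equal to its
      projection.\<close>
    then have "q = ((Re p * Re q + Im p * Im q) / (Re p * Re p + Im p * Im p)) *\<^sub>R p"
      using pp by (simp add: complex_eq_iff eq_divide_eq)
    then have "collinear {0, p, q}" by (metis collinear_lemma)
    then have "collinear {b, a, c}" unfolding p_def q_def by (subst collinear_3) auto
    then show False using assms by (simp add: insert_commute)
  qed
  have sumD: "orient y b c + orient a y c + orient a b y = D" for y
    unfolding orient_def D_def by (simp add: algebra_simps)
  have aff: "s * u + t * u = u" if "s + t = 1" for s t u :: real
    using that by (metis distrib_right mult_1)
  have cont: "continuous_on UNIV (\<lambda>y. orient y b c / D)" "continuous_on UNIV (\<lambda>y. orient a y c / D)"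
    "continuous_on UNIV (\<lambda>y. orient a b y / D)"
    unfolding orient_def by (intro continuous_intros; simp add: D)+
  have w: "w = 1 - u - v" if "u + v + w = 1" for u v w :: real using that by simp
  have t: "t = 1 - s" if "s + t = 1" for s t :: real using that by simp
  show ?thesis
  proof (rule that[OF cont])
    show "orient y b c / D + orient a y c / D + orient a b y / D = 1" for y
      using sumD[of y] D by (simp flip: add_divide_distrib)
    show "y = (orient y b c / D) *\<^sub>R a + (orient a y c / D) *\<^sub>R b + (orient a b y / D) *\<^sub>R c" for y
    proof -
      have "D * Re y = orient y b c * Re a + orient a y c * Re b + orient a b y * Re c"
        "D * Im y = orient y b c * Im a + orient a y c * Im b + orient a b y * Im c"
        unfolding orient_def D_def by (simp_all add: algebra_simps)
      then show ?thesis using D by (simp add: complex_eq_iff field_simps)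
    qed
    fix u v w :: real assume "u + v + w = 1"
    note w = w[OF this]
    show "orient (u *\<^sub>R a + v *\<^sub>R b + w *\<^sub>R c) b c / D = u"
      "orient a (u *\<^sub>R a + v *\<^sub>R b + w *\<^sub>R c) c / D = v"
      "orient a b (u *\<^sub>R a + v *\<^sub>R b + w *\<^sub>R c) / D = w"
      using D unfolding w by (simp_all add: divide_eq_eq) (simp_all add: orient_def D_def algebra_simps)
  next
    fix s t :: real and x y assume "s + t = 1"
    note t = t[OF this]
    show "orient (s *\<^sub>R x + t *\<^sub>R y) b c / D = s * (orient x b c / D) + t * (orient y b c / D)"
      "orient a (s *\<^sub>R x + t *\<^sub>R y) c / D = s * (orient a x c / D) + t * (orient a y c / D)"
      "orient a b (s *\<^sub>R x + t *\<^sub>R y) / D = s * (orient a b x / D) + t * (orient a b y / D)"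
      unfolding t using D by (simp_all add: divide_eq_eq distrib_right) (simp_all add: orient_def algebra_simps)
  qed
qed

lemma in_convex_hull_3I:
  assumes "u \<ge> 0" "v \<ge> 0" "w \<ge> 0" "u + v + w = 1" "y = u *\<^sub>R a + v *\<^sub>R b + w *\<^sub>R c"
  shows "y \<in> convex hull {a, b, c}"
  unfolding convex_hull_3 using assms by blast

text \<open>On the way from \<open>a\<close> to \<open>d\<close> the coefficient of \<open>a\<close>
  falls from 1 to \<open>x < 0\<close>. It vanishes at parameter \<open>1 / (1 - x)\<close>, and the
  point reached there has nonnegative weights at \<open>b\<close> and \<open>c\<close> only.\<close>

lemma segments_cross:
  fixes a b c d :: "'a::real_vector"
  assumes "d = x *\<^sub>R a + y *\<^sub>R b + z *\<^sub>R c" "x + y + z = 1" "x < 0" "y \<ge> 0" "z \<ge> 0"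
  shows "closed_segment b c \<inter> closed_segment a d \<noteq> {}"
proof -
  define p where "p = (1 - z / (1 - x)) *\<^sub>R b + (z / (1 - x)) *\<^sub>R c"
  have yz: "1 - z / (1 - x) = y / (1 - x)" using assms by (simp add: field_simps)
  have "z \<le> 1 - x" using assms by simp
  then have "p \<in> closed_segment b c"
    unfolding p_def closed_segment_def using assms by (intro CollectI exI[of _ "z / (1 - x)"]) auto
  moreover have "p = (1 - 1 / (1 - x)) *\<^sub>R a + (1 / (1 - x)) *\<^sub>R d"
  proof -
    have "(1 - 1 / (1 - x)) *\<^sub>R a + (1 / (1 - x)) *\<^sub>R d
      = ((1 - 1 / (1 - x)) + x / (1 - x)) *\<^sub>R a + (y / (1 - x)) *\<^sub>R b + (z / (1 - x)) *\<^sub>R c"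
      by (simp add: assms(1) scaleR_add_right scaleR_left_distrib)
    moreover have "(1 - 1 / (1 - x)) + x / (1 - x) = 0" using assms by (simp add: field_simps)
    ultimately show ?thesis by (simp add: p_def yz)
  qed
  then have "p \<in> closed_segment a d"
    unfolding closed_segment_def using assms by (intro CollectI exI[of _ "1 / (1 - x)"]) auto
  ultimately show ?thesis by blast
qed

text \<open>The hypotheses force \<open>c\<close> and \<open>d\<close> to lie on different sides of the line through \<open>a\<close> and \<open>b\<close>.\<close>

lemma two_triangles_cover_edge:
  fixes a b c d :: complex
  assumes nc: "\<not> collinear {a, b, c}" "\<not> collinear {a, b, d}"
    and out: "d \<notin> convex hull {a, b, c}" "c \<notin> convex hull {a, b, d}"
    and disj: "closed_segment a c \<inter> closed_segment b d = {}" "closed_segment b c \<inter> closed_segment a d = {}"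
    and x: "x \<in> open_segment a b"
  shows "x \<in> interior (convex hull {a, b, c} \<union> convex hull {a, b, d})"
proof -
  obtain \<alpha> \<beta> \<gamma> :: "complex \<Rightarrow> real" where
    cont: "continuous_on UNIV \<alpha>" "continuous_on UNIV \<beta>" "continuous_on UNIV \<gamma>"
    and sum: "\<And>y. \<alpha> y + \<beta> y + \<gamma> y = 1" and eq: "\<And>y. y = \<alpha> y *\<^sub>R a + \<beta> y *\<^sub>R b + \<gamma> y *\<^sub>R c"
    and uni: "\<And>u v w. u + v + w = 1 \<Longrightarrow> \<alpha> (u *\<^sub>R a + v *\<^sub>R b + w *\<^sub>R c) = u"
    "\<And>u v w. u + v + w = 1 \<Longrightarrow> \<beta> (u *\<^sub>R a + v *\<^sub>R b + w *\<^sub>R c) = v"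
    "\<And>u v w. u + v + w = 1 \<Longrightarrow> \<gamma> (u *\<^sub>R a + v *\<^sub>R b + w *\<^sub>R c) = w"
    by (rule barycentric_coordinates[OF nc(1)]) blast
  define da db dc where "da = \<alpha> d" and "db = \<beta> d" and "dc = \<gamma> d"
  have d: "d = da *\<^sub>R a + db *\<^sub>R b + dc *\<^sub>R c" and dsum: "da + db + dc = 1"
    unfolding da_def db_def dc_def by (fact eq, fact sum)
  have "dc \<noteq> 0"
  proof
    assume "dc = 0"
    then have "d = da *\<^sub>R a + db *\<^sub>R b" "da + db = 1" using d dsum by simp_all
    then have "d \<in> affine hull {a, b}" unfolding affine_hull_2 by blast
    then show False using nc(2) affine_hull_3_imp_collinear by blast
  qed
  have "\<not> dc > 0"
  proof
    assume pos: "dc > 0"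
    \<comment> \<open>If \<open>d\<close> were on the side of \<open>c\<close>, the signs of its
      other coordinates would leave four regions: \<open>d\<close> in the first triangle, one of two
      crossings of sides, or \<open>c\<close> in the second triangle. Each is excluded by one
      hypothesis.\<close>
    consider "da \<ge> 0" "db \<ge> 0" | "da < 0" "db \<ge> 0" | "da \<ge> 0" "db < 0" | "da < 0" "db < 0" by linarith
    then show False
    proof cases
      case 1
      then show False using in_convex_hull_3I[OF _ _ _ dsum d] pos out(1) by simp
    next
      case 2
      then show False using segments_cross[OF d dsum] pos disj(2) by simp
    next
      case 3
      have "d = db *\<^sub>R b + da *\<^sub>R a + dc *\<^sub>R c" "db + da + dc = 1"
        using d dsum by simp_all
      from segments_cross[OF this] 3 pos disj(1) show False by simp
    next
      case 4
      have "c = (- da / dc) *\<^sub>R a + (- db / dc) *\<^sub>R b + (1 / dc) *\<^sub>R d"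
        unfolding d using pos by (simp add: scaleR_add_right)
      moreover have "- da / dc + - db / dc + 1 / dc = 1" using dsum pos by (simp add: field_simps)
      ultimately have "c \<in> convex hull {a, b, d}"
        using 4 pos by (intro in_convex_hull_3I[of "- da / dc" "- db / dc" "1 / dc"]) (auto simp: divide_nonpos_pos)
      then show False using out(2) by blast
    qed
  qed
  with \<open>dc \<noteq> 0\<close> have dc: "dc < 0" by simp
  \<comment> \<open>The last two expressions are the coordinates of \<open>y\<close> at
    \<open>a\<close> and \<open>b\<close> in the triangle \<open>a b d\<close>, obtained by
    expressing \<open>c\<close> through \<open>d\<close>. They agree with \<open>\<alpha> y\<close>
    and \<open>\<beta> y\<close> on the line \<open>\<gamma> y = 0\<close>, so they are positive at
    \<open>x\<close>.\<close>
  define W where "W = {y. \<alpha> y > 0} \<inter> {y. \<beta> y > 0} \<inter>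
    {y. \<alpha> y - \<gamma> y * (da / dc) > 0} \<inter> {y. \<beta> y - \<gamma> y * (db / dc) > 0}"
  have "open W"
    unfolding W_def by (intro open_Int open_Collect_less continuous_intros cont)
  moreover have "x \<in> W"
  proof -
    obtain u where u: "0 < u" "u < 1" "x = (1 - u) *\<^sub>R a + u *\<^sub>R b + 0 *\<^sub>R c"
      using x by (auto simp: in_segment)
    then have "\<alpha> x = 1 - u" "\<beta> x = u" "\<gamma> x = 0"
      using uni[of "1 - u" u 0] by auto
    with u show ?thesis by (simp add: W_def)
  qed
  moreover have "W \<subseteq> convex hull {a, b, c} \<union> convex hull {a, b, d}"
  proof
    fix y assume y: "y \<in> W"
    show "y \<in> convex hull {a, b, c} \<union> convex hull {a, b, d}"
    proof (cases "\<gamma> y \<ge> 0")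
      case True
      then have "y \<in> convex hull {a, b, c}"
        using y by (intro in_convex_hull_3I[OF _ _ _ sum eq]) (auto simp: W_def)
      then show ?thesis by blast
    next
      case False
      have 1: "y = (\<alpha> y - \<gamma> y * (da / dc)) *\<^sub>R a + (\<beta> y - \<gamma> y * (db / dc)) *\<^sub>R b + (\<gamma> y / dc) *\<^sub>R d"
        using \<open>dc \<noteq> 0\<close>
        by (subst eq[of y], subst d) (simp add: scaleR_add_right scaleR_diff_left)
      have 2: "(\<alpha> y - \<gamma> y * (da / dc)) + (\<beta> y - \<gamma> y * (db / dc)) + \<gamma> y / dc = 1"
      proof -
        have "(\<alpha> y - \<gamma> y * (da / dc)) + (\<beta> y - \<gamma> y * (db / dc)) + \<gamma> y / dc
          = \<alpha> y + \<beta> y + \<gamma> y * ((1 - da - db) / dc)"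
          by (simp add: diff_divide_distrib add_divide_distrib algebra_simps)
        also have "(1 - da - db) / dc = 1" using dsum dc by simp
        finally show ?thesis using sum[of y] by simp
      qed
      have "y \<in> convex hull {a, b, d}"
        using y False dc by (intro in_convex_hull_3I[OF _ _ _ 2 1]) (auto simp: W_def divide_nonpos_neg)
      then show ?thesis by blast
    qed
  qed
  ultimately show ?thesis by (meson interiorI)
qed

lemma triangle_half_planes:
  fixes a b c :: complex
  assumes "\<not> collinear {a, b, c}"
  obtains f :: "nat \<Rightarrow> complex \<Rightarrow> real" where
    "\<And>i. convex {y. f i y > 0}" "\<And>i. convex {y. f i y \<le> 0}"
    "interior (convex hull {a, b, c}) = {y. \<forall>i<3. f i y > 0}"
proof -
  obtain \<alpha> \<beta> \<gamma> :: "complex \<Rightarrow> real" where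
    cont: "continuous_on UNIV \<alpha>" "continuous_on UNIV \<beta>" "continuous_on UNIV \<gamma>"
    and sum: "\<And>y. \<alpha> y + \<beta> y + \<gamma> y = 1" and eq: "\<And>y. y = \<alpha> y *\<^sub>R a + \<beta> y *\<^sub>R b + \<gamma> y *\<^sub>R c"
    and uni: "\<And>u v w. u + v + w = 1 \<Longrightarrow> \<alpha> (u *\<^sub>R a + v *\<^sub>R b + w *\<^sub>R c) = u"
    "\<And>u v w. u + v + w = 1 \<Longrightarrow> \<beta> (u *\<^sub>R a + v *\<^sub>R b + w *\<^sub>R c) = v"
    "\<And>u v w. u + v + w = 1 \<Longrightarrow> \<gamma> (u *\<^sub>R a + v *\<^sub>R b + w *\<^sub>R c) = w"
    and aff: "\<And>s t x y. s + t = 1 \<Longrightarrow> \<alpha> (s *\<^sub>R x + t *\<^sub>R y) = s * \<alpha> x + t * \<alpha> y"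
    "\<And>s t x y. s + t = 1 \<Longrightarrow> \<beta> (s *\<^sub>R x + t *\<^sub>R y) = s * \<beta> x + t * \<beta> y"
    "\<And>s t x y. s + t = 1 \<Longrightarrow> \<gamma> (s *\<^sub>R x + t *\<^sub>R y) = s * \<gamma> x + t * \<gamma> y"
    by (rule barycentric_coordinates[OF assms]) blast
  \<comment> \<open>The three barycentric coordinates; every index from 2 on means \<gamma>, so
    convexity holds for all indices. Numbering the sides makes it possible to speak of the first
    side that a point violates.\<close>
  define f where "f i = (if i = (0::nat) then \<alpha> else if i = 1 then \<beta> else \<gamma>)" for i
  have f_aff: "f i (s *\<^sub>R x + t *\<^sub>R y) = s * f i x + t * f i y" if "s + t = 1" for i s t x y
    using that by (simp add: f_def aff)
  have comb: "s * p + t * q > 0" if "s \<ge> 0" "t \<ge> 0" "s + t = 1" "p > 0" "q > 0" for s t p q :: real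
    using that by (metis add_nonneg_pos add_pos_nonneg add.right_neutral mult_nonneg_nonneg mult_pos_pos
        less_eq_real_def zero_neq_one)
  show ?thesis
  proof (rule that[of f])
    show "convex {y. f i y > 0}" for i
      unfolding convex_def by (simp add: f_aff comb)
    show "convex {y. f i y \<le> 0}" for i
      unfolding convex_def by (simp add: f_aff add_nonpos_nonpos mult_nonneg_nonpos)
    have three: "(\<forall>i<3. f i y > 0) \<longleftrightarrow> \<alpha> y > 0 \<and> \<beta> y > 0 \<and> \<gamma> y > 0" for y
      by (auto simp: f_def numeral_3_eq_3 less_Suc_eq)
    show "interior (convex hull {a, b, c}) = {y. \<forall>i<3. f i y > 0}"
      unfolding interior_convex_hull_3_minimal[OF assms DIM_complex] three
      using uni sum eq by (auto; metis)
  qed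
qed

text \<open>\<open>N\<close> holds the points where \<open>S\<close> is not known to be a
  neighbourhood. Deleting finitely many points leaves \<open>D\<close> connected, so
  \<open>S\<close> fills \<open>D - N\<close>; the remainder \<open>D - S\<close> is open and
  finite, hence empty.\<close>

lemma clopen_filling:
  fixes D :: "complex set"
  assumes "open D" "connected D" "finite N" "closed S"
    and "D \<inter> S - N \<noteq> {}" "D \<inter> S - N \<subseteq> interior S"
  shows "D \<subseteq> S"
proof -
  have "connected (D - N)" using assms by (intro connected_open_delete_finite) auto
  moreover have "open (interior S)" "open (- S)" using assms by auto
  moreover have "D - N \<subseteq> interior S \<union> - S" "interior S \<inter> - S \<inter> (D - N) = {}"
    using assms(6) interior_subset by blast+
  moreover have "interior S \<inter> (D - N) \<noteq> {}" using assms(5,6) by blast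
  ultimately have "- S \<inter> (D - N) = {}" by (metis connectedD)
  then have "D - S \<subseteq> N" by blast
  then have "finite (D - S)" using assms(3) finite_subset by blast
  moreover have "open (D - S)" using assms by blast
  ultimately have "D - S = {}" using finite_imp_not_open by blast
  then show ?thesis by blast
qed

lemma connected_graph_induct:
  assumes "connected_graph W F" "u \<in> W" "v \<in> W" "P u"
    and "\<And>x y. {x, y} \<in> F \<Longrightarrow> P x \<Longrightarrow> P y"
  shows "P v"
proof -
  have "(u, v) \<in> {(x, y). {x, y} \<in> F}\<^sup>*" using assms(1-3) unfolding connected_graph_def by blast
  then show ?thesis by (induction rule: rtrancl_induct) (use assms(4,5) in auto)
qed

section \<open>Triangles and edges in a crossing-free straight line drawing\<close>

locale straight_drawing =
  fixes V :: "'v set" and E :: "'v set set" and \<rho> :: "'v \<Rightarrow> complex"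
  assumes graph: "simple_graph V E" and straight: "plane_straight_line_drawing V E \<rho>"
begin

definition triple :: "'v set \<Rightarrow> bool" where
  "triple t \<longleftrightarrow> card t = 3 \<and> t \<subseteq> V \<and> (\<forall>u\<in>t. \<forall>v\<in>t. u \<noteq> v \<longrightarrow> {u, v} \<in> E)"

abbreviation tri :: "'v set \<Rightarrow> complex set" where
  "tri t \<equiv> convex hull (\<rho> ` t)"

lemma inj: "inj_on \<rho> V"
  using straight by (simp add: plane_straight_line_drawing_def drawing_def)

lemma edge_ends: "{u, v} \<in> E \<Longrightarrow> u \<in> V \<and> v \<in> V \<and> u \<noteq> v"
  using graph unfolding simple_graph_def by (auto simp: card_insert_if split: if_splits)

lemma on_edge:
  assumes "{u, v} \<in> E" "w \<in> V" "\<rho> w \<in> closed_segment (\<rho> u) (\<rho> v)"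
  shows "w \<in> {u, v}"
proof -
  have "\<rho> w \<in> {\<rho> u, \<rho> v}"
    using assms straight unfolding plane_straight_line_drawing_def by blast
  then show ?thesis using inj assms(2) edge_ends[OF assms(1)] by (auto dest: inj_onD)
qed

lemma disjoint_edges:
  assumes "{u, v} \<in> E" "{x, y} \<in> E" "{u, v} \<inter> {x, y} = {}"
  shows "closed_segment (\<rho> u) (\<rho> v) \<inter> closed_segment (\<rho> x) (\<rho> y) = {}"
proof -
  have "{u, v} \<noteq> {x, y}" using assms(3) by blast
  then have "closed_segment (\<rho> u) (\<rho> v) \<inter> closed_segment (\<rho> x) (\<rho> y) = \<rho> ` ({u, v} \<inter> {x, y})"
    using assms(1,2) straight unfolding plane_straight_line_drawing_def by blast
  then show ?thesis using assms(3) by simp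
qed

text \<open>The corners are not collinear because one of them would then lie on the edge joining the
  other two.\<close>

lemma tripleE:
  assumes "triple t"
  obtains a b c where "t = {a, b, c}" "a \<noteq> b" "b \<noteq> c" "a \<noteq> c" "{a, b} \<in> E" "{b, c} \<in> E" "{c, a} \<in> E"
    "\<not> collinear {\<rho> a, \<rho> b, \<rho> c}"
proof -
  obtain a b c where abc: "t = {a, b, c}" "a \<noteq> b" "b \<noteq> c" "a \<noteq> c"
    using assms by (auto simp: triple_def card_3_iff)
  then have E: "{a, b} \<in> E" "{b, c} \<in> E" "{c, a} \<in> E" "a \<in> V" "b \<in> V" "c \<in> V"
    using assms by (auto simp: triple_def)
  have "\<not> collinear {\<rho> a, \<rho> b, \<rho> c}"
    using on_edge[OF E(1,6)] on_edge[OF E(2,4)] on_edge[OF E(3,5)] abc(2-4)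
    by (auto simp: collinear_between_cases between_mem_segment)
  with abc E that show ?thesis by blast
qed

lemma triple_not_collinear:
  assumes "triple t"
  shows "\<not> collinear (\<rho> ` t)"
proof -
  obtain a b c where "t = {a, b, c}" "\<not> collinear {\<rho> a, \<rho> b, \<rho> c}"
    using tripleE[OF assms] by metis
  then show ?thesis by simp
qed

lemma compact_tri: "finite t \<Longrightarrow> compact (tri t)"
  by (simp add: finite_imp_compact_convex_hull)

lemma triple_finite: "triple t \<Longrightarrow> finite t"
  by (metis triple_def card.infinite zero_neq_numeral)

lemma triple_subset_frontier:
  assumes "triple t" "v \<in> t"
  shows "\<rho> v \<in> tri t" "\<rho> v \<notin> interior (tri t)"
proof -
  obtain a b c where abc: "t = {a, b, c}"
    "\<not> collinear {\<rho> a, \<rho> b, \<rho> c}" using tripleE[OF assms(1)] by metis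
  show "\<rho> v \<in> tri t" using assms(2) by (simp add: hull_inc)
  show "\<rho> v \<notin> interior (tri t)"
    using assms(2) interior_of_triangle[of "\<rho> a" "\<rho> b" "\<rho> c"] by (auto simp: abc(1))
qed

lemma frontier_tri:
  assumes "triple t" "y \<in> frontier (tri t)"
  obtains u v where "u \<in> t" "v \<in> t" "{u, v} \<in> E" "y \<in> closed_segment (\<rho> u) (\<rho> v)"
proof -
  obtain a b c where abc: "t = {a, b, c}" "{a, b} \<in> E" "{b, c} \<in> E" "{c, a} \<in> E"
    using tripleE[OF assms(1)] by metis
  have "y \<in> closed_segment (\<rho> a) (\<rho> b) \<union> closed_segment (\<rho> b) (\<rho> c) \<union> closed_segment (\<rho> c) (\<rho> a)"
    using assms(2) frontier_of_triangle[of "\<rho> a" "\<rho> b" "\<rho> c"] by (simp add: abc(1))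
  then show ?thesis using that abc by blast
qed

lemma vertex_off_triple:
  assumes "triple t" "v \<in> V - t"
  shows "\<rho> v \<in> interior (tri t) \<longleftrightarrow> \<rho> v \<in> tri t"
proof -
  have "\<rho> v \<notin> frontier (tri t)"
  proof
    assume "\<rho> v \<in> frontier (tri t)"
    then obtain x y where "x \<in> t" "y \<in> t" "{x, y} \<in> E" "\<rho> v \<in> closed_segment (\<rho> x) (\<rho> y)"
      by (rule frontier_tri[OF assms(1)])
    then show False using on_edge[of x y v] assms(2) by blast
  qed
  moreover have "closed (tri t)"
    using compact_tri triple_finite assms(1) compact_imp_closed by blast
  ultimately show ?thesis using interior_subset by (auto simp: frontier_def)
qed

lemma edge_off_triple:
  assumes "triple t" "{u, v} \<in> E" "{u, v} \<inter> t = {}"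
  shows "closed_segment (\<rho> u) (\<rho> v) \<inter> frontier (tri t) = {}" "\<rho> u \<in> tri t \<Longrightarrow> \<rho> v \<in> tri t"
proof -
  have "False" if z: "z \<in> closed_segment (\<rho> u) (\<rho> v)" "z \<in> frontier (tri t)" for z
  proof -
    obtain x y where "x \<in> t" "y \<in> t" "{x, y} \<in> E" "z \<in> closed_segment (\<rho> x) (\<rho> y)"
      using z(2) by (rule frontier_tri[OF assms(1)])
    then show False using disjoint_edges[OF assms(2), of x y] z(1) assms(3) by blast
  qed
  then show *: "closed_segment (\<rho> u) (\<rho> v) \<inter> frontier (tri t) = {}" by blast
  show "\<rho> v \<in> tri t" if "\<rho> u \<in> tri t"
    using connected_Int_frontier[OF connected_segment, of "\<rho> u" "\<rho> v" "tri t"] * that by auto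
qed

text \<open>An edge disjoint from \<open>t\<close> cannot cross the triangle, so membership in it
  spreads along the edges of \<open>W\<close>. This turns non-separation into an all-or-nothing
  statement about the drawing.\<close>

lemma connected_off_triple:
  assumes "triple t" "W \<subseteq> V - t" "connected_graph W (induced_edges E W)"
  shows "\<rho> ` W \<subseteq> interior (tri t) \<or> \<rho> ` W \<inter> tri t = {}"
proof -
  have "\<rho> v \<in> tri t" if "u \<in> W" "v \<in> W" "\<rho> u \<in> tri t" for u v
    using assms(3) that
  proof (rule connected_graph_induct)
    fix x y assume xy: "{x, y} \<in> induced_edges E W" "\<rho> x \<in> tri t"
    then have "{x, y} \<in> E" "{x, y} \<inter> t = {}" using assms(2) by (auto simp: induced_edges_def)
    then show "\<rho> y \<in> tri t" using edge_off_triple(2)[OF assms(1)] xy(2) by blast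
  qed
  then show ?thesis using vertex_off_triple[OF assms(1)] assms(2) by blast
qed

text \<open>A side of \<open>t'\<close> meeting the triangle of \<open>t\<close> has both ends
  outside it, so it would cross a side of \<open>t\<close>, which is an edge disjoint from it. Hence
  the triangle of \<open>t\<close> misses the frontier of the other one and, if they met, would lie
  inside it together with its corners.\<close>

lemma disjoint_triples:
  assumes "triple t" "triple t'"
    and "\<And>v. v \<in> t' \<Longrightarrow> \<rho> v \<notin> tri t" "\<And>v. v \<in> t \<Longrightarrow> \<rho> v \<notin> tri t'"
  shows "tri t \<inter> tri t' = {}"
proof (rule ccontr)
  assume ne: "tri t \<inter> tri t' \<noteq> {}"
  have disj: "t \<inter> t' = {}" using assms(3) triple_subset_frontier(1)[OF assms(1)] by blast
  have "tri t \<inter> frontier (tri t') = {}"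
  proof (rule ccontr)
    assume "tri t \<inter> frontier (tri t') \<noteq> {}"
    then obtain z where z: "z \<in> tri t" "z \<in> frontier (tri t')" by blast
    obtain x y where xy: "x \<in> t'" "y \<in> t'" "{x, y} \<in> E" "z \<in> closed_segment (\<rho> x) (\<rho> y)"
      using z(2) by (rule frontier_tri[OF assms(2)])
    have "closed_segment (\<rho> x) (\<rho> y) \<inter> frontier (tri t) \<noteq> {}"
      by (rule connected_Int_frontier) (use xy z assms(3) in auto)
    moreover have "{x, y} \<inter> t = {}" using xy disj by blast
    ultimately show False using edge_off_triple(1)[OF assms(1) xy(3)] by blast
  qed
  moreover have "connected (tri t)" by (simp add: convex_connected)
  ultimately have "tri t - tri t' = {}" using connected_Int_frontier ne by blast
  moreover obtain v where "v \<in> t" using assms(1) by (rule tripleE) blast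
  ultimately show False using triple_subset_frontier(1)[OF assms(1)] assms(4) by blast
qed

end

text \<open>The curves of the given embedding are forgotten here. \<open>\<Phi>\<close> plays the
  role of the facial triples, and \<open>two\<close> and \<open>nonsep\<close> carry all that is
  needed of their being facial.\<close>

locale drawn_triangulation = straight_drawing +
  fixes U :: "'a set" and \<Phi> :: "'a set set"
  assumes U: "U \<subseteq> V" and ne: "\<Phi> \<noteq> {}"
    and triples: "\<And>t. t \<in> \<Phi> \<Longrightarrow> triple t \<and> t \<subseteq> U"
    and two: "\<And>a b. {a, b} \<in> E \<Longrightarrow> a \<in> U \<Longrightarrow> b \<in> U \<Longrightarrow>
           \<exists>c d. c \<noteq> d \<and> c \<notin> {a, b} \<and> d \<notin> {a, b} \<and> {a, b, c} \<in> \<Phi> \<and> {a, b, d} \<in> \<Phi>"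
    and nonsep: "\<And>t. t \<in> \<Phi> \<Longrightarrow> connected_graph (U - t) (induced_edges E (U - t))"
begin

lemma finite_\<Phi>: "finite \<Phi>"
proof -
  have "finite U" using U graph finite_subset unfolding simple_graph_def by blast
  moreover have "\<Phi> \<subseteq> Pow U" using triples by blast
  ultimately show ?thesis using finite_subset by blast
qed

lemma inside_or_outside:
  assumes "t \<in> \<Phi>"
  shows "\<rho> ` (U - t) \<subseteq> interior (tri t) \<or> \<rho> ` (U - t) \<inter> tri t = {}"
  using connected_off_triple[of t "U - t"] nonsep triples assms U by blast

text \<open>The union of the triangles is closed, and around every non-vertex point of it in
  \<open>D\<close> it is a neighbourhood: on an edge, the two empty triangles of \<open>two\<close>
  lie on opposite sides, and \<open>edges\<close> keeps both in \<open>\<Psi>\<close>. So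
  \<open>clopen_filling\<close> applies, with the vertices as exceptional points.\<close>

lemma empty_triangles_cover:
  assumes \<Psi>: "\<Psi> \<subseteq> \<Phi>" "\<And>t. t \<in> \<Psi> \<Longrightarrow> \<rho> ` (U - t) \<inter> tri t = {}"
    and D: "open D" "connected D" "t0 \<in> \<Psi>" "interior (tri t0) \<subseteq> D"
    and edges: "\<And>a b c. {a, b, c} \<in> \<Psi> \<Longrightarrow> {a, b} \<in> E \<Longrightarrow> open_segment (\<rho> a) (\<rho> b) \<inter> D \<noteq> {} \<Longrightarrow>
      {t \<in> \<Phi>. {a, b} \<subseteq> t} \<subseteq> \<Psi>"
  shows "D \<subseteq> (\<Union>t\<in>\<Psi>. tri t)"
proof (rule clopen_filling[OF D(1,2)])
  have fin: "finite \<Psi>" using \<Psi>(1) finite_\<Phi> finite_subset by blast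
  show finU: "finite (\<rho> ` U)" using U graph finite_subset unfolding simple_graph_def by blast
  have "closed (tri t)" if "t \<in> \<Psi>" for t
    using compact_tri triple_finite triples that \<Psi>(1) compact_imp_closed by blast
  then show "closed (\<Union>t\<in>\<Psi>. tri t)" using fin by (intro closed_UN) auto
  have triple0: "triple t0" using triples D(3) \<Psi>(1) by blast
  have "interior (tri t0) \<noteq> {}"
  proof -
    obtain a b c where abc: "t0 = {a, b, c}" "\<not> collinear {\<rho> a, \<rho> b, \<rho> c}"
      using tripleE[OF triple0] by metis
    have "(1/3) *\<^sub>R \<rho> a + (1/3) *\<^sub>R \<rho> b + (1/3) *\<^sub>R \<rho> c \<in> interior (convex hull {\<rho> a, \<rho> b, \<rho> c})"
      unfolding interior_convex_hull_3_minimal[OF abc(2) DIM_complex]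
      by (intro CollectI exI[of _ "1/3"]) auto
    then show ?thesis by (auto simp: abc(1))
  qed
  then have "infinite (interior (tri t0))" using finite_imp_not_open by blast
  then have "interior (tri t0) - \<rho> ` U \<noteq> {}" using finU by (metis Diff_eq_empty_iff finite_subset)
  then show "D \<inter> (\<Union>t\<in>\<Psi>. tri t) - \<rho> ` U \<noteq> {}" using D(3,4) interior_subset by blast
  show "D \<inter> (\<Union>t\<in>\<Psi>. tri t) - \<rho> ` U \<subseteq> interior (\<Union>t\<in>\<Psi>. tri t)"
  proof
    fix x assume x: "x \<in> D \<inter> (\<Union>t\<in>\<Psi>. tri t) - \<rho> ` U"
    then obtain t where t: "t \<in> \<Psi>" "x \<in> tri t" by blast
    then have tr: "triple t" "t \<subseteq> U" using triples \<Psi>(1) by blast+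
    show "x \<in> interior (\<Union>t\<in>\<Psi>. tri t)"
    proof (cases "x \<in> interior (tri t)")
      case True
      moreover have "interior (tri t) \<subseteq> interior (\<Union>t\<in>\<Psi>. tri t)"
        using t(1) by (intro interior_mono) blast
      ultimately show ?thesis by blast
    next
      case False
      then have "x \<in> frontier (tri t)" using t(2) closure_subset by (auto simp: frontier_def)
      then obtain a b where ab: "a \<in> t" "b \<in> t" "{a, b} \<in> E" "x \<in> closed_segment (\<rho> a) (\<rho> b)"
        by (rule frontier_tri[OF tr(1)])
      then have xab: "x \<in> open_segment (\<rho> a) (\<rho> b)" using x tr(2) by (auto simp: open_segment_def)
      obtain c0 where "t = {a, b, c0}"
      proof -
        have "a \<noteq> b" using edge_ends[OF ab(3)] by simp
        then have "card (t - {a, b}) = 1" using ab tr(1) triple_finite[OF tr(1)]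
          by (simp add: triple_def card_Diff_subset)
        then obtain c0 where "t - {a, b} = {c0}" by (auto simp: card_1_singleton_iff)
        then show ?thesis using that[of c0] ab by blast
      qed
      then have sub: "{t \<in> \<Phi>. {a, b} \<subseteq> t} \<subseteq> \<Psi>" using edges[of a b c0] t(1) ab(3) xab x by blast
      have "a \<in> U" "b \<in> U" using ab tr(2) by blast+
      then obtain c d where cd: "c \<noteq> d" "c \<notin> {a, b}" "d \<notin> {a, b}" "{a, b, c} \<in> \<Phi>" "{a, b, d} \<in> \<Phi>"
        using two[OF ab(3)] by blast
      then have cd\<Psi>: "{a, b, c} \<in> \<Psi>" "{a, b, d} \<in> \<Psi>" using sub by blast+
      have tc: "triple {a, b, c}" "triple {a, b, d}" and cdU: "c \<in> U" "d \<in> U"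
        using triples cd by blast+
      have nab: "a \<noteq> b" using edge_ends[OF ab(3)] by simp
      have E: "{a, c} \<in> E" "{b, c} \<in> E" "{a, d} \<in> E" "{b, d} \<in> E"
        using tc cd(2,3) by (auto simp: triple_def)
      have nc: "\<not> collinear {\<rho> a, \<rho> b, \<rho> c}" "\<not> collinear {\<rho> a, \<rho> b, \<rho> d}"
        using triple_not_collinear[OF tc(1)] triple_not_collinear[OF tc(2)] by simp_all
      have "x \<in> interior (convex hull {\<rho> a, \<rho> b, \<rho> c} \<union> convex hull {\<rho> a, \<rho> b, \<rho> d})"
      proof (rule two_triangles_cover_edge[OF nc _ _ _ _ xab])
        have "\<rho> d \<in> \<rho> ` (U - {a, b, c})" "\<rho> c \<in> \<rho> ` (U - {a, b, d})" using cd(1-3) cdU by auto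
        then show "\<rho> d \<notin> convex hull {\<rho> a, \<rho> b, \<rho> c}" "\<rho> c \<notin> convex hull {\<rho> a, \<rho> b, \<rho> d}"
          using \<Psi>(2)[OF cd\<Psi>(1)] \<Psi>(2)[OF cd\<Psi>(2)] by auto
        show "closed_segment (\<rho> a) (\<rho> c) \<inter> closed_segment (\<rho> b) (\<rho> d) = {}"
          "closed_segment (\<rho> b) (\<rho> c) \<inter> closed_segment (\<rho> a) (\<rho> d) = {}"
          using disjoint_edges[OF E(1,4)] disjoint_edges[OF E(2,3)] cd(1-3) nab by blast+
      qed
      moreover have "convex hull {\<rho> a, \<rho> b, \<rho> c} \<union> convex hull {\<rho> a, \<rho> b, \<rho> d} \<subseteq> (\<Union>t\<in>\<Psi>. tri t)"
        using UN_upper[OF cd\<Psi>(1), of tri] UN_upper[OF cd\<Psi>(2), of tri] by simp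
      ultimately show ?thesis using interior_mono[of "convex hull {\<rho> a, \<rho> b, \<rho> c} \<union> convex hull {\<rho> a, \<rho> b, \<rho> d}"]
        by blast
    qed
  qed
qed

text \<open>If all triangles were empty, they would cover the whole plane, but finitely many
  triangles are bounded.\<close>

lemma outer_triangle_exists: "\<exists>t\<in>\<Phi>. \<rho> ` (U - t) \<subseteq> interior (tri t)"
proof (rule ccontr)
  assume "\<not> ?thesis"
  then have "\<rho> ` (U - t) \<inter> tri t = {}" if "t \<in> \<Phi>" for t using inside_or_outside that by blast
  moreover obtain t0 where "t0 \<in> \<Phi>" using ne by blast
  ultimately have "UNIV \<subseteq> (\<Union>t\<in>\<Phi>. tri t)"
    by (intro empty_triangles_cover[of \<Phi> UNIV t0]) auto
  moreover have "bounded (\<Union>t\<in>\<Phi>. tri t)"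
    using finite_\<Phi> compact_tri triple_finite triples compact_imp_bounded by (intro bounded_UN) blast+
  ultimately show False using not_bounded_UNIV by (metis top.extremum_uniqueI)
qed

definition outer :: "'a set" where
  "outer = (SOME t. t \<in> \<Phi> \<and> \<rho> ` (U - t) \<subseteq> interior (tri t))"

lemma outer: "outer \<in> \<Phi>" "\<rho> ` (U - outer) \<subseteq> interior (tri outer)"
  using someI_ex[OF outer_triangle_exists[unfolded Bex_def]] unfolding outer_def by auto

lemma inside_imp_U_subset:
  assumes "\<rho> ` (U - t) \<subseteq> interior (tri t)"
  shows "\<rho> ` U \<subseteq> tri t"
proof -
  have "\<rho> v \<in> tri t" if "v \<in> U" for v
  proof (cases "v \<in> t")
    case False
    then have "\<rho> v \<in> interior (tri t)" using assms that by blast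
    then show ?thesis using interior_subset[of "tri t"] by (rule subsetD[rotated])
  qed (simp add: hull_inc)
  then show ?thesis by blast
qed

lemmas U_in_outer = inside_imp_U_subset[OF outer(2)]

lemma tri_subset_outer:
  assumes "t \<subseteq> U" shows "tri t \<subseteq> tri outer"
  using assms U_in_outer by (intro hull_minimal) auto

text \<open>A second triangle containing \<open>U\<close> would have the same convex hull as
  \<open>outer\<close>; yet one of its corners is not in \<open>outer\<close> and so lies in the
  interior of this hull.\<close>

lemma other_triangles_empty:
  assumes "t \<in> \<Phi>" "t \<noteq> outer"
  shows "\<rho> ` (U - t) \<inter> tri t = {}"
proof (rule ccontr)
  assume "\<rho> ` (U - t) \<inter> tri t \<noteq> {}"
  then have "\<rho> ` (U - t) \<subseteq> interior (tri t)" using inside_or_outside assms by blast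
  then have "\<rho> ` U \<subseteq> tri t" by (rule inside_imp_U_subset)
  then have "tri outer \<subseteq> tri t" using triples[OF outer(1)] by (intro hull_minimal) auto
  then have eq: "tri t = tri outer" using tri_subset_outer triples[OF assms(1)] by blast
  have "card t = 3" "card outer = 3"
    using triples[OF outer(1)] triples[OF assms(1)] unfolding triple_def by simp_all
  then have "\<not> t \<subseteq> outer" using assms(2) triple_finite triples[OF outer(1)] by (metis card_subset_eq)
  then obtain v where v: "v \<in> t" "v \<notin> outer" by blast
  then have "\<rho> v \<in> interior (tri outer)" using outer(2) triples[OF assms(1)] by blast
  then show False using triple_subset_frontier(2)[of t v] triples[OF assms(1)] v eq by simp
qed

text \<open>An edge meeting the interior of the outer triangle is not one of its sides, so no
  triangle on it is \<open>outer\<close>. The covering argument therefore works in that interior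
  with \<open>outer\<close> removed.\<close>

lemma outer_covered: "interior (tri outer) \<subseteq> (\<Union>t\<in>\<Phi> - {outer}. tri t)"
proof -
  have tro: "triple outer" "outer \<subseteq> U" using triples outer(1) by blast+
  obtain t0 where t0: "t0 \<in> \<Phi>" "t0 \<noteq> outer"
  proof -
    obtain a b c where abc: "outer = {a, b, c}" "{a, b} \<in> E" using tripleE[OF tro(1)] by metis
    then have "a \<in> U" "b \<in> U" using tro(2) by simp_all
    then obtain c' d' where cd: "c' \<noteq> d'" "c' \<notin> {a, b}" "{a, b, c'} \<in> \<Phi>" "{a, b, d'} \<in> \<Phi>"
      using two[OF abc(2)] by metis
    then have "c' \<in> {a, b, c'}" "c' \<notin> {a, b, d'}" by simp_all
    then have "{a, b, c'} \<noteq> {a, b, d'}" by metis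
    with cd(3,4) that show ?thesis by metis
  qed
  show ?thesis
  proof (rule empty_triangles_cover[of "\<Phi> - {outer}" _ t0])
    show "interior (tri t0) \<subseteq> interior (tri outer)"
      using triples t0 by (intro interior_mono tri_subset_outer) blast
    show "connected (interior (tri outer))"
      by (intro convex_connected convex_interior convex_convex_hull)
    fix a b c assume h: "{a, b, c} \<in> \<Phi> - {outer}" "{a, b} \<in> E"
      "open_segment (\<rho> a) (\<rho> b) \<inter> interior (tri outer) \<noteq> {}"
    have "\<not> {a, b} \<subseteq> outer"
    proof
      assume ab: "{a, b} \<subseteq> outer"
      have "a \<noteq> b" using edge_ends[OF h(2)] by simp
      then have "card (outer - {a, b}) = 1" using ab tro(1) triple_finite[OF tro(1)]
        by (simp add: triple_def card_Diff_subset)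
      then obtain c0 where "outer - {a, b} = {c0}" by (auto simp: card_1_singleton_iff)
      then have "outer = {a, b, c0}" using ab by blast
      then have "interior (tri outer) \<inter> closed_segment (\<rho> a) (\<rho> b) = {}"
        using interior_of_triangle[of "\<rho> a" "\<rho> b" "\<rho> c0"] by auto
      then show False using h(3) by (auto simp: open_segment_def)
    qed
    then show "{t \<in> \<Phi>. {a, b} \<subseteq> t} \<subseteq> \<Phi> - {outer}" by blast
  qed (use t0 other_triangles_empty in auto)
qed

end

section \<open>Scattered triangulations\<close>

text \<open>A path between two sides of a split must use an edge between them; conversely, the
  vertices reachable from \<open>u\<close> split off without edges. Splits are the form in which the
  topological argument delivers connectedness and in which cuts are manipulated below.\<close>

lemma connected_graph_induced_iff:
  "connected_graph W (induced_edges E W) \<longleftrightarrow> W \<noteq> {} \<and>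
     (\<forall>A B. A \<union> B = W \<longrightarrow> A \<inter> B = {} \<longrightarrow> (\<forall>a\<in>A. \<forall>b\<in>B. {a, b} \<notin> E) \<longrightarrow> A = {} \<or> B = {})"
    (is "?L \<longleftrightarrow> ?R")
proof
  assume L: ?L
  have "A = {} \<or> B = {}"
    if AB: "A \<union> B = W" "A \<inter> B = {}" "\<forall>a\<in>A. \<forall>b\<in>B. {a, b} \<notin> E" for A B
  proof (rule ccontr)
    assume "\<not> (A = {} \<or> B = {})"
    then obtain a b where ab: "a \<in> A" "b \<in> B" by blast
    have "a \<in> W" "b \<in> W" using ab AB(1) by blast+
    from L this ab(1) have "b \<in> A"
    proof (rule connected_graph_induct)
      fix x y assume "{x, y} \<in> induced_edges E W" "x \<in> A"
      then show "y \<in> A" using AB unfolding induced_edges_def by blast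
    qed
    then show False using ab AB(2) by blast
  qed
  moreover have "W \<noteq> {}" using L unfolding connected_graph_def by blast
  ultimately show ?R by blast
next
  assume R: ?R
  show ?L
    unfolding connected_graph_def
  proof (intro conjI ballI)
    show "W \<noteq> {}" using R by blast
    fix u v assume uv: "u \<in> W" "v \<in> W"
    define A where "A = {w \<in> W. (u, w) \<in> {(x, y). {x, y} \<in> induced_edges E W}\<^sup>*}"
    have "{a, b} \<notin> E" if ab: "a \<in> A" "b \<in> W - A" for a b
    proof
      assume "{a, b} \<in> E"
      then have "{a, b} \<in> induced_edges E W" using ab by (auto simp: induced_edges_def A_def)
      then have "(a, b) \<in> {(x, y). {x, y} \<in> induced_edges E W}" by blast
      moreover have "(u, a) \<in> {(x, y). {x, y} \<in> induced_edges E W}\<^sup>*" using ab(1) unfolding A_def by blast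
      ultimately have "b \<in> A" using ab(2) unfolding A_def by (simp add: rtrancl_into_rtrancl)
      then show False using ab(2) by blast
    qed
    moreover have "A \<union> (W - A) = W" unfolding A_def by blast
    ultimately have "A = {} \<or> W - A = {}" using R by blast
    moreover have "u \<in> A" using uv(1) unfolding A_def by blast
    ultimately have "v \<in> A" using uv(2) by blast
    then show "(u, v) \<in> {(x, y). {x, y} \<in> induced_edges E W}\<^sup>*" unfolding A_def by blast
  qed
qed

lemma connected_graph_no_split:
  assumes "connected_graph W (induced_edges E W)" "A \<union> B = W" "A \<inter> B = {}"
    and "\<And>a b. a \<in> A \<Longrightarrow> b \<in> B \<Longrightarrow> {a, b} \<notin> E"
  shows "A = {} \<or> B = {}"
  using assms(1)[unfolded connected_graph_induced_iff] assms(2-4) by simp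

text \<open>\<open>k4\<close> ensures that a facial triple never exhausts its part. This gives two
  different facial triangles at every edge, and a nonempty rest for \<open>connected_graph\<close>
  after deleting a triple.\<close>

locale scattered_triangulations =
  fixes k :: nat and V :: "'v set" and E :: "'v set set"
    and pos :: "'v \<Rightarrow> complex" and crv :: "'v set \<Rightarrow> real \<Rightarrow> complex"
    and P :: "nat \<Rightarrow> 'v set"
  assumes k4: "k \<ge> 4" and plane: "plane_graph V E pos crv"
    and connected3: "vertex_connected 3 V E"
    and V: "V = (\<Union>i<k. P i)"
    and disj: "\<And>i j. i < k \<Longrightarrow> j < k \<Longrightarrow> i \<noteq> j \<Longrightarrow> P i \<inter> P j = {}"
    and card_P: "\<And>i. i < k \<Longrightarrow> card (P i) = k"
    and triangulation: "\<And>i. i < k \<Longrightarrow> plane_triangulation (P i) (induced_edges E (P i)) pos crv"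
    and outside: "\<And>i j. i < k \<Longrightarrow> j < k \<Longrightarrow> i \<noteq> j \<Longrightarrow>
           plane_image (P j) (induced_edges E (P j)) pos crv
             \<subseteq> outer_face (P i) (induced_edges E (P i)) pos crv"
begin

abbreviation EP where "EP i \<equiv> induced_edges E (P i)"
abbreviation MP where "MP i \<equiv> plane_image (P i) (EP i) pos crv"

definition facials :: "nat \<Rightarrow> 'v set set" where
  "facials i = {t. \<exists>G. facial (P i) (EP i) pos crv G t}"

definition outer_facial :: "nat \<Rightarrow> 'v set" where
  "outer_facial i = (SOME t. facial (P i) (EP i) pos crv (outside (MP i)) t)"

lemma part: "i < k \<Longrightarrow> triangulated_plane (P i) (EP i) pos crv"
  by (simp add: triangulated_plane_def triangulation)

lemma outer_facial:
  assumes "i < k"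
  shows "facial (P i) (EP i) pos crv (outside (MP i)) (outer_facial i)"
  unfolding outer_facial_def
  by (rule someI_ex) (use triangulated_plane.outer_facial[OF part[OF assms]] in blast)

lemma outer_facial_in: "i < k \<Longrightarrow> outer_facial i \<in> facials i"
  using outer_facial by (auto simp: facials_def)

lemma facialsD:
  assumes "i < k" "t \<in> facials i"
  shows "card t = 3" "t \<subseteq> P i" "\<And>u v. u \<in> t \<Longrightarrow> v \<in> t \<Longrightarrow> u \<noteq> v \<Longrightarrow> {u, v} \<in> E" "P i - t \<noteq> {}"
proof -
  obtain G where G: "facial (P i) (EP i) pos crv G t" using assms(2) by (auto simp: facials_def)
  note D = triangulated_plane.facialD[OF part[OF assms(1)] G]
  show t: "card t = 3" "t \<subseteq> P i" by (fact D)+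
  show "{u, v} \<in> E" if "u \<in> t" "v \<in> t" "u \<noteq> v" for u v
    using D(7)[of "{u, v}"] that by (simp add: induced_edges_def)
  have "t \<noteq> P i" using t(1) card_P[OF assms(1)] k4 by auto
  then show "P i - t \<noteq> {}" using t(2) by blast
qed

lemma facials_nonseparating:
  assumes "i < k" "t \<in> facials i"
  shows "connected_graph (P i - t) (induced_edges E (P i - t))"
  unfolding connected_graph_induced_iff
proof (intro conjI allI impI)
  show "P i - t \<noteq> {}" by (rule facialsD(4)[OF assms])
  obtain G where G: "facial (P i) (EP i) pos crv G t" using assms(2) by (auto simp: facials_def)
  fix A B assume AB: "A \<union> B = P i - t" "A \<inter> B = {}" "\<forall>a\<in>A. \<forall>b\<in>B. {a, b} \<notin> E"
  show "A = {} \<or> B = {}"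
    by (rule triangulated_plane.facial_triangle_nonseparating_sets[OF part[OF assms(1)] _ G AB(1,2)])
       (use AB(3) card_P[OF assms(1)] k4 in \<open>auto simp: induced_edges_def\<close>)
qed

lemma facials_two:
  assumes i: "i < k" and ab: "{a, b} \<in> E" "a \<in> P i" "b \<in> P i"
  shows "\<exists>c d. c \<noteq> d \<and> c \<notin> {a, b} \<and> d \<notin> {a, b} \<and> {a, b, c} \<in> facials i \<and> {a, b, d} \<in> facials i"
proof -
  have "card (P i) \<ge> 4" using card_P[OF i] k4 by simp
  moreover have "{a, b} \<in> EP i" using ab by (simp add: induced_edges_def)
  ultimately obtain t t' G G' where "facial (P i) (EP i) pos crv G t" "facial (P i) (EP i) pos crv G' t'"
    and t: "t \<noteq> t'" "{a, b} \<subseteq> t" "{a, b} \<subseteq> t'"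
    by (rule triangulated_plane.edge_on_two_facial_triangles[OF part[OF i]])
  then have mem: "t \<in> facials i" "t' \<in> facials i" by (auto simp: facials_def)
  have "card {a, b} = 2" using plane_graphD(4)[OF plane ab(1)] by simp
  have "\<exists>c. c \<notin> {a, b} \<and> s = {a, b, c}" if "s \<in> facials i" "{a, b} \<subseteq> s" for s
  proof -
    have "card (s - {a, b}) = 1"
      using facialsD(1)[OF i that(1)] \<open>card {a, b} = 2\<close> that(2) by (simp add: card_Diff_subset)
    then obtain c where "s - {a, b} = {c}" by (auto simp: card_1_singleton_iff)
    then show ?thesis using that(2) by (intro exI[of _ c]) blast
  qed
  then obtain c d where "c \<notin> {a, b}" "t = {a, b, c}" "d \<notin> {a, b}" "t' = {a, b, d}"
    using mem t by meson
  then show ?thesis using mem t(1) by (intro exI[of _ c] exI[of _ d]) auto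
qed

lemma in_other_part:
  assumes "i < k" "w \<in> V - P i"
  shows "pos w \<in> outside (MP i)"
proof -
  obtain j where j: "j < k" "w \<in> P j" using assms(2) V by blast
  then have "j \<noteq> i" using assms(2) by blast
  moreover have "pos w \<in> MP j" using j(2) by (auto simp: plane_image_def)
  ultimately show ?thesis using outside[OF assms(1) j(1)] unfolding outer_face_def by blast
qed

text \<open>The curve of the edge meets the image of part \<open>i\<close> only at
  \<open>pos v\<close> and ends at a vertex in its unbounded face, so
  \<open>arc_from_outer_face\<close> applies.\<close>

lemma contact_in_outer_facial:
  assumes i: "i < k" and vw: "{v, w} \<in> E" "v \<in> P i" "w \<in> V - P i"
  shows "v \<in> outer_facial i"
proof -
  note pg = plane_graphD[OF plane]
  have PV: "P i \<subseteq> V" using i V by blast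
  obtain g where g: "arc g" "path_image g = path_image (crv {v, w})" "pathstart g = pos v" "pathfinish g = pos w"
    by (rule arc_oriented[OF pg(5)[OF vw(1)], of "pos v" "pos w"]) (use pg(6)[OF vw(1)] in auto)
  have "path_image g \<inter> MP i \<subseteq> {pos v}"
  proof
    fix z assume z: "z \<in> path_image g \<inter> MP i"
    then consider x where "x \<in> P i" "z = pos x" | f where "f \<in> EP i" "z \<in> path_image (crv f)"
      unfolding plane_image_def by blast
    then show "z \<in> {pos v}"
    proof cases
      case 1
      then have "pos x \<in> pos ` {v, w}" using pg(7)[OF vw(1)] z g(2) PV by blast
      then have "x \<in> {v, w}" using pg(3,4) vw(1) 1(1) PV by (metis inj_on_image_mem_iff subsetD)
      then show ?thesis using 1 vw(3) by blast
    next
      case 2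
      then have f: "f \<in> E" "f \<subseteq> P i" by (auto simp: induced_edges_def)
      then have "{v, w} \<noteq> f" using vw(3) by blast
      then have "z \<in> pos ` ({v, w} \<inter> f)" using pg(8)[OF vw(1) f(1)] z 2(2) g(2) by blast
      then show ?thesis using f(2) vw(3) by blast
    qed
  qed
  then show ?thesis
    using triangulated_plane.arc_from_outer_face[OF part[OF i] outer_facial[OF i] vw(2) g(1,3)]
      in_other_part[OF i vw(3)] g(4) by simp
qed

text \<open>A separating inner facial triangle would share with the outer one all contacts of a
  component, contradicting 3-connectivity.\<close>

lemma inner_facial_nonseparating:
  assumes i: "i < k" and t: "t \<in> facials i" "t \<noteq> outer_facial i"
  shows "connected_graph (V - t) (induced_edges E (V - t))"
proof -
  note tD = facialsD[OF i t(1)]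
  have PV: "P i \<subseteq> V" using i V by blast
  have *: "B = {}"
    if AB: "A \<union> B = V - t" "A \<inter> B = {}" "\<And>a b. a \<in> A \<Longrightarrow> b \<in> B \<Longrightarrow> {a, b} \<notin> E" and PA: "P i - t \<subseteq> A" for A B
  proof -
    \<comment> \<open>Two different triples share at most two vertices, so \<open>V - S\<close> is
      still connected. Any neighbour of \<open>B\<close> in \<open>t\<close> is a contact, hence in
      the outer triple, hence in \<open>S\<close>: after deleting \<open>S\<close>, nothing joins
      \<open>B\<close> to the rest.\<close>
    define S where "S = outer_facial i \<inter> t"
    have fin: "finite t" using tD(1) by (metis card.infinite zero_neq_numeral)
    have "S \<noteq> t"
    proof
      assume "S = t"
      then have "t \<subseteq> outer_facial i" unfolding S_def by blast
      moreover have "card (outer_facial i) = 3" using facialsD(1)[OF i outer_facial_in[OF i]] .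
      ultimately show False using t(2) tD(1)
        by (metis card.infinite card_subset_eq zero_neq_numeral)
    qed
    then have "card S < 3" using tD(1) fin psubset_card_mono[of t S] unfolding S_def by auto
    moreover have "S \<subseteq> V" using tD(2) PV unfolding S_def by blast
    ultimately have conn: "connected_graph (V - S) (induced_edges E (V - S))"
      using connected3 unfolding vertex_connected_def by blast
    have "{x, b} \<notin> E" if x: "x \<in> V - S - B" and b: "b \<in> B" for x b
    proof
      assume e: "{x, b} \<in> E"
      have "b \<in> V - P i" using b AB(1,2) PA by blast
      moreover have "x \<in> t" using AB e x b by blast
      ultimately have "x \<in> outer_facial i" using contact_in_outer_facial[OF i e] tD(2) by blast
      then show False using x \<open>x \<in> t\<close> unfolding S_def by blast
    qed
    moreover have "(V - S - B) \<union> B = V - S" using AB(1) unfolding S_def by blast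
    ultimately have "V - S - B = {} \<or> B = {}"
      by (intro connected_graph_no_split[OF conn]) auto
    moreover have "P i - t \<subseteq> V - S - B" using PA AB(2) PV unfolding S_def by blast
    ultimately show ?thesis using tD(4) by blast
  qed
  show ?thesis
    unfolding connected_graph_induced_iff
  proof (intro conjI allI impI)
    show "V - t \<noteq> {}" using tD(4) PV by blast
    fix A B assume AB: "A \<union> B = V - t" "A \<inter> B = {}" "\<forall>a\<in>A. \<forall>b\<in>B. {a, b} \<notin> E"
    \<comment> \<open>The rest of the part is connected by itself, so it lies on one side of the
      split; the other side then contains only vertices of other parts.\<close>
    have "(A \<inter> P i) \<union> (B \<inter> P i) = P i - t" using AB(1) PV by blast
    then have "A \<inter> P i = {} \<or> B \<inter> P i = {}"
      by (rule connected_graph_no_split[OF facials_nonseparating[OF i t(1)]]) (use AB(2,3) in auto)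
    then have "P i - t \<subseteq> A \<or> P i - t \<subseteq> B" using AB(1) PV by blast
    then show "A = {} \<or> B = {}"
    proof
      assume "P i - t \<subseteq> A"
      then show ?thesis using *[of A B] AB by blast
    next
      assume "P i - t \<subseteq> B"
      then show ?thesis using *[of B A] AB by (metis Un_commute inf_commute insert_commute)
    qed
  qed
qed

end

section \<open>The given triangulations as they appear in a straight line drawing\<close>

locale drawn_scattered_triangulations = scattered_triangulations +
  fixes \<rho> :: "'a \<Rightarrow> complex"
  assumes straight_line: "plane_straight_line_drawing V E \<rho>"
begin

sublocale straight_drawing V E \<rho>
  using plane straight_line by unfold_locales (simp_all add: plane_graph_def)

lemma part_subset: "i < k \<Longrightarrow> P i \<subseteq> V"
  using V by blast

lemma facials_triple: "i < k \<Longrightarrow> t \<in> facials i \<Longrightarrow> triple t"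
  using facialsD part_subset unfolding triple_def by blast

lemma drawn_part:
  assumes "i < k"
  shows "drawn_triangulation V E \<rho> (P i) (facials i)"
proof
  show "P i \<subseteq> V" by (rule part_subset[OF assms])
  show "facials i \<noteq> {}" using outer_facial_in[OF assms] by blast
  show "triple t \<and> t \<subseteq> P i" if "t \<in> facials i" for t
    using facials_triple[OF assms that] facialsD(2)[OF assms that] by blast
  show "connected_graph (P i - t) (induced_edges E (P i - t))" if "t \<in> facials i" for t
    by (rule facials_nonseparating[OF assms that])
qed (rule facials_two[OF assms])

text \<open>The facial triple whose triangle contains the part in the drawing, in contrast to
  \<open>outer_facial i\<close>, which bounds the unbounded face of the part in the given
  embedding.\<close>

definition drawn_outer :: "nat \<Rightarrow> 'a set" where
  "drawn_outer i = drawn_triangulation.outer \<rho> (P i) (facials i)"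

lemma drawn_outer:
  assumes "i < k"
  shows "drawn_outer i \<in> facials i" "triple (drawn_outer i)" "drawn_outer i \<subseteq> P i"
    "\<rho> ` (P i - drawn_outer i) \<subseteq> interior (tri (drawn_outer i))" "\<rho> ` P i \<subseteq> tri (drawn_outer i)"
    "\<And>t. t \<in> facials i \<Longrightarrow> t \<noteq> drawn_outer i \<Longrightarrow> \<rho> ` (P i - t) \<inter> tri t = {}"
    "interior (tri (drawn_outer i)) \<subseteq> (\<Union>t\<in>facials i - {drawn_outer i}. tri t)"
proof -
  note D = drawn_part[OF assms]
  show *: "drawn_outer i \<in> facials i" unfolding drawn_outer_def by (rule drawn_triangulation.outer(1)[OF D])
  show "triple (drawn_outer i)" "drawn_outer i \<subseteq> P i"
    by (rule facials_triple[OF assms *], rule facialsD(2)[OF assms *])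
  show "\<rho> ` (P i - drawn_outer i) \<subseteq> interior (tri (drawn_outer i))"
    unfolding drawn_outer_def by (rule drawn_triangulation.outer(2)[OF D])
  show "\<rho> ` P i \<subseteq> tri (drawn_outer i)"
    unfolding drawn_outer_def by (rule drawn_triangulation.U_in_outer[OF D])
  show "\<rho> ` (P i - t) \<inter> tri t = {}" if "t \<in> facials i" "t \<noteq> drawn_outer i" for t
    using drawn_triangulation.other_triangles_empty[OF D] that unfolding drawn_outer_def by blast
  show "interior (tri (drawn_outer i)) \<subseteq> (\<Union>t\<in>facials i - {drawn_outer i}. tri t)"
    unfolding drawn_outer_def by (rule drawn_triangulation.outer_covered[OF D])
qed

lemma inner_facial_dichotomy:
  assumes "i < k" "t \<in> facials i" "t \<noteq> outer_facial i"
  shows "\<rho> ` (V - t) \<subseteq> interior (tri t) \<or> \<rho> ` (V - t) \<inter> tri t = {}"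
  by (rule connected_off_triple[OF facials_triple[OF assms(1,2)] subset_refl
        inner_facial_nonseparating[OF assms]])

text \<open>All of \<open>V - t\<close> is on one side of the triangle, and a vertex of the part off
  \<open>t\<close> decides which: it is known to be outside.\<close>

lemma inner_facial_empty:
  assumes "i < k" "t \<in> facials i" "t \<noteq> outer_facial i" "t \<noteq> drawn_outer i"
  shows "\<rho> ` (V - t) \<inter> tri t = {}"
proof (rule ccontr)
  assume "\<rho> ` (V - t) \<inter> tri t \<noteq> {}"
  then have "\<rho> ` (V - t) \<subseteq> interior (tri t)"
    using inner_facial_dichotomy[OF assms(1-3)] by blast
  moreover obtain v where "v \<in> P i - t" using facialsD(4)[OF assms(1,2)] by blast
  ultimately have "\<rho> v \<in> tri t" using part_subset[OF assms(1)] interior_subset by blast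
  then show False using drawn_outer(6)[OF assms(1,2,4)] \<open>v \<in> P i - t\<close> by blast
qed

text \<open>An inverted triangulation is turned inside out by the drawing: all other triangulations end up
  inside its former outer triangle.\<close>

definition inverted :: "nat \<Rightarrow> bool" where
  "inverted i \<longleftrightarrow> drawn_outer i \<noteq> outer_facial i"

text \<open>A foreign vertex in the triangle would lie in one of the smaller triangles that cover
  its interior, but these are all inner facial triangles and hence empty.\<close>

lemma not_inverted:
  assumes i: "i < k" "\<not> inverted i" and v: "v \<in> V - P i"
  shows "\<rho> v \<notin> tri (drawn_outer i)"
proof
  assume "\<rho> v \<in> tri (drawn_outer i)"
  moreover have "v \<in> V - drawn_outer i" using v drawn_outer(3)[OF i(1)] by blast
  ultimately have "\<rho> v \<in> interior (tri (drawn_outer i))"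
    using vertex_off_triple[OF drawn_outer(2)[OF i(1)]] by blast
  then obtain t where t: "t \<in> facials i" "t \<noteq> drawn_outer i" "\<rho> v \<in> tri t"
    using drawn_outer(7)[OF i(1)] by blast
  have "v \<in> V - t" using v facialsD(2)[OF i(1) t(1)] by blast
  moreover have "t \<noteq> outer_facial i" using t(2) i(2) unfolding inverted_def by simp
  ultimately show False using inner_facial_empty[OF i(1) t(1) _ t(2)] t(3) by blast
qed

text \<open>Here \<open>drawn_outer i\<close> is an inner facial triangle of the given embedding, so
  it does not separate and everything else is drawn inside it. A vertex of another part lies in one
  of the covering triangles, and only \<open>outer_facial i\<close> is not known to be empty of
  foreign vertices.\<close>

lemma inverted:
  assumes i: "i < k" "inverted i"
  shows "\<rho> ` (V - drawn_outer i) \<subseteq> interior (tri (drawn_outer i))"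
    "\<And>v. v \<in> V - P i \<Longrightarrow> \<rho> v \<in> interior (tri (outer_facial i))"
    "\<And>v. v \<in> P i \<Longrightarrow> \<rho> v \<notin> interior (tri (outer_facial i))"
proof -
  have neq: "drawn_outer i \<noteq> outer_facial i" using i(2) by (simp add: inverted_def)
  have trO: "triple (outer_facial i)" by (rule facials_triple[OF i(1) outer_facial_in[OF i(1)]])
  obtain w where w: "w \<in> P i - drawn_outer i" using facialsD(4)[OF i(1) drawn_outer(1)[OF i(1)]] by blast
  then have "\<rho> w \<in> tri (drawn_outer i)" using drawn_outer(5)[OF i(1)] by blast
  then show all: "\<rho> ` (V - drawn_outer i) \<subseteq> interior (tri (drawn_outer i))"
    using inner_facial_dichotomy[OF i(1) drawn_outer(1)[OF i(1)] neq] w part_subset[OF i(1)] by blast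
  show "\<rho> v \<in> interior (tri (outer_facial i))" if v: "v \<in> V - P i" for v
  proof -
    have "v \<in> V - drawn_outer i" using v drawn_outer(3)[OF i(1)] by blast
    then obtain t where t: "t \<in> facials i" "t \<noteq> drawn_outer i" "\<rho> v \<in> tri t"
      using drawn_outer(7)[OF i(1)] all by blast
    have "v \<in> V - t" using v facialsD(2)[OF i(1) t(1)] by blast
    then have "t = outer_facial i" using inner_facial_empty[OF i(1) t(1) _ t(2)] t(3) by blast
    then show ?thesis using vertex_off_triple[OF trO] \<open>v \<in> V - t\<close> t(3) by blast
  qed
  show "\<rho> v \<notin> interior (tri (outer_facial i))" if v: "v \<in> P i" for v
  proof (cases "v \<in> outer_facial i")
    case True
    then show ?thesis using triple_subset_frontier(2)[OF trO] by blast
  next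
    case False
    then have "\<rho> v \<notin> tri (outer_facial i)"
      using drawn_outer(6)[OF i(1) outer_facial_in[OF i(1)] neq[symmetric]] v by blast
    then show ?thesis using interior_subset by blast
  qed
qed

text \<open>Both drawn outer triangles would contain all vertices, hence be the same triangle; but
  the corners of one are interior to the other.\<close>

lemma inverted_unique:
  assumes i: "i < k" "inverted i" and j: "j < k" "inverted j"
  shows "i = j"
proof (rule ccontr)
  assume "i \<noteq> j"
  have all: "\<rho> ` V \<subseteq> tri (drawn_outer l)" if l: "l < k" "inverted l" for l
  proof -
    have "\<rho> v \<in> tri (drawn_outer l)" if "v \<in> V" for v
    proof (cases "v \<in> drawn_outer l")
      case False
      then have "\<rho> v \<in> interior (tri (drawn_outer l))" using inverted(1)[OF l] that by blast
      then show ?thesis using interior_subset[of "tri (drawn_outer l)"] by (rule subsetD[rotated])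
    qed (simp add: hull_inc)
    then show ?thesis by blast
  qed
  have sub: "tri (drawn_outer l) \<subseteq> tri (drawn_outer m)" if "l < k" "m < k" "inverted m" for l m
  proof (rule hull_minimal)
    show "\<rho> ` drawn_outer l \<subseteq> tri (drawn_outer m)"
      using all[OF that(2,3)] drawn_outer(3)[OF that(1)] part_subset[OF that(1)] by blast
  qed (rule convex_convex_hull)
  have eq: "tri (drawn_outer i) = tri (drawn_outer j)" using sub i j by blast
  obtain v where v: "v \<in> drawn_outer j" using tripleE[OF drawn_outer(2)[OF j(1)]] by blast
  have "v \<in> P j" using v drawn_outer(3)[OF j(1)] by blast
  then have "v \<in> V - drawn_outer i"
    using disj[OF i(1) j(1) \<open>i \<noteq> j\<close>] drawn_outer(3)[OF i(1)] part_subset[OF j(1)] by blast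
  then have "\<rho> v \<in> interior (tri (drawn_outer j))" using inverted(1)[OF i] eq by auto
  then show False using triple_subset_frontier(2)[OF drawn_outer(2)[OF j(1)] v] by blast
qed

lemma parts_disjoint_hulls:
  assumes "i < k" "\<not> inverted i" "j < k" "\<not> inverted j" "i \<noteq> j"
  shows "tri (drawn_outer i) \<inter> tri (drawn_outer j) = {}"
proof (rule disjoint_triples)
  show "\<rho> v \<notin> tri (drawn_outer i)" if "v \<in> drawn_outer j" for v
  proof (rule not_inverted[OF assms(1,2)])
    have "v \<in> P j" using that drawn_outer(3)[OF assms(3)] by blast
    then show "v \<in> V - P i" using disj[OF assms(1,3,5)] part_subset[OF assms(3)] by blast
  qed
  show "\<rho> v \<notin> tri (drawn_outer j)" if "v \<in> drawn_outer i" for v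
  proof (rule not_inverted[OF assms(3,4)])
    have "v \<in> P i" using that drawn_outer(3)[OF assms(1)] by blast
    then show "v \<in> V - P j" using disj[OF assms(1,3,5)] part_subset[OF assms(1)] by blast
  qed
qed (use drawn_outer assms in auto)

text \<open>An inverted triangulation is split into three classes according to the first side of the
  triangle around the other triangulations that separates a vertex from them.\<close>

lemma separated_classes:
  obtains col :: "'a \<Rightarrow> nat" where "card (col ` V) \<le> k + 2"
    "\<And>u v i j. i < k \<Longrightarrow> j < k \<Longrightarrow> u \<in> P i \<Longrightarrow> v \<in> P j \<Longrightarrow> col u = col v \<Longrightarrow> i = j"
    "\<And>u u' v v'. {u, u', v, v'} \<subseteq> V \<Longrightarrow> col u = col u' \<Longrightarrow> col v = col v' \<Longrightarrow>
       closed_segment (\<rho> u) (\<rho> u') \<inter> closed_segment (\<rho> v) (\<rho> v') \<noteq> {} \<Longrightarrow> col u = col v"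
proof -
  have "\<exists>i<k. v \<in> P i" if "v \<in> V" for v using that V by blast
  then obtain idx where idx: "\<And>v. v \<in> V \<Longrightarrow> idx v < k \<and> v \<in> P (idx v)" by metis
  have idx_eq: "idx v = i" if "i < k" "v \<in> P i" for v i
    using disj[of "idx v" i] idx[of v] that part_subset[OF that(1)] by blast
  have seg: "closed_segment (\<rho> u) (\<rho> u') \<inter> closed_segment (\<rho> v) (\<rho> v') = {}"
    if "convex A" "convex B" "A \<inter> B = {}" "{\<rho> u, \<rho> u'} \<subseteq> A" "{\<rho> v, \<rho> v'} \<subseteq> B" for u u' v v' A B
    using closed_segment_subset[of "\<rho> u" A "\<rho> u'"] closed_segment_subset[of "\<rho> v" B "\<rho> v'"] that by blast
  have in_tri: "\<rho> v \<in> tri (drawn_outer (idx v))" if "v \<in> V" for v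
    using drawn_outer(5) idx[OF that] by blast
  have outs: "closed_segment (\<rho> u) (\<rho> u') \<inter> closed_segment (\<rho> v) (\<rho> v') = {}"
    if "{u, u', v, v'} \<subseteq> V" "idx u = idx u'" "idx v = idx v'" "idx u \<noteq> idx v"
      "\<not> inverted (idx u)" "\<not> inverted (idx v)" for u u' v v'
  proof (rule seg[OF convex_convex_hull convex_convex_hull])
    show "tri (drawn_outer (idx u)) \<inter> tri (drawn_outer (idx v)) = {}"
      using parts_disjoint_hulls[of "idx u" "idx v"] idx that by auto
    show "{\<rho> u, \<rho> u'} \<subseteq> tri (drawn_outer (idx u))" "{\<rho> v, \<rho> v'} \<subseteq> tri (drawn_outer (idx v))"
      using in_tri[of u] in_tri[of u'] in_tri[of v] in_tri[of v'] that(1-3) by auto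
  qed
  show ?thesis
  proof (cases "\<exists>j<k. inverted j")
    case False
    show ?thesis
    proof (rule that[of idx])
      have "idx ` V \<subseteq> {..<k}" using idx by auto
      then have "card (idx ` V) \<le> k" using card_mono[of "{..<k}"] by fastforce
      then show "card (idx ` V) \<le> k + 2" by simp
      show "i = j" if "i < k" "j < k" "u \<in> P i" "v \<in> P j" "idx u = idx v" for u v i j
        using idx_eq that by metis
      show "idx u = idx v" if "{u, u', v, v'} \<subseteq> V" "idx u = idx u'" "idx v = idx v'"
        "closed_segment (\<rho> u) (\<rho> u') \<inter> closed_segment (\<rho> v) (\<rho> v') \<noteq> {}" for u u' v v'
        using outs[of u u' v v'] that False idx by blast
    qed
  next
    case True
    then obtain j where j: "j < k" "inverted j" by blast
    obtain a b c where abc: "outer_facial j = {a, b, c}" "\<not> collinear {\<rho> a, \<rho> b, \<rho> c}"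
      using tripleE[OF facials_triple[OF j(1) outer_facial_in[OF j(1)]]] by metis
    obtain f :: "nat \<Rightarrow> complex \<Rightarrow> real" where f: "\<And>i. convex {y. f i y > 0}" "\<And>i. convex {y. f i y \<le> 0}"
      "interior (convex hull {\<rho> a, \<rho> b, \<rho> c}) = {y. \<forall>i<3. f i y > 0}"
      using triangle_half_planes[OF abc(2)] by blast
    then have int: "interior (tri (outer_facial j)) = {y. \<forall>i<3. f i y > 0}" by (simp add: abc(1))
    define side where "side v = (LEAST l. f l (\<rho> v) \<le> 0)" for v
    \<comment> \<open>The shift by \<open>k\<close> keeps the class numbers of the inverted part
      away from the part indices.\<close>
    define col where "col v = (if idx v = j then k + side v else idx v)" for v
    have side: "side v < 3" "f (side v) (\<rho> v) \<le> 0" "\<And>l. l < side v \<Longrightarrow> f l (\<rho> v) > 0" if v: "v \<in> P j" for v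
    proof -
      obtain l where l: "l < 3" "f l (\<rho> v) \<le> 0" using inverted(3)[OF j v] int by force
      show "f (side v) (\<rho> v) \<le> 0" unfolding side_def by (rule LeastI[of _ l]) (rule l(2))
      have "side v \<le> l" unfolding side_def by (rule Least_le) (rule l(2))
      then show "side v < 3" using l(1) by simp
      show "f m (\<rho> v) > 0" if "m < side v" for m
        using not_less_Least[OF that[unfolded side_def]] by simp
    qed
    have others: "f l (\<rho> v) > 0" if "v \<in> V" "idx v \<noteq> j" "l < 3" for v l
    proof -
      have "v \<in> V - P j" using that idx_eq j(1) by blast
      then show ?thesis using inverted(2)[OF j] int that(3) by blast
    qed
    have Pj: "v \<in> P j" if "v \<in> V" "idx v = j" for v using idx[OF that(1)] that(2) by blast
    have split: "closed_segment (\<rho> u) (\<rho> u') \<inter> closed_segment (\<rho> v) (\<rho> v') = {}"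
      if "f l (\<rho> u) \<le> 0" "f l (\<rho> u') \<le> 0" "f l (\<rho> v) > 0" "f l (\<rho> v') > 0" for l u u' v v'
      by (rule seg[OF f(2)[of l] f(1)[of l]]) (use that in auto)
    have less: "closed_segment (\<rho> u) (\<rho> u') \<inter> closed_segment (\<rho> v) (\<rho> v') = {}"
      if uv: "{u, u', v, v'} \<subseteq> V" "col u = col u'" "col v = col v'" "col u > col v" for u u' v v'
    proof -
      have small: "idx w < k" if "w \<in> V" for w using idx[OF that] by blast
      show ?thesis
      proof (cases "idx u = j")
        case uj: True
        then have uj': "idx u' = j" using uv(1,2) small[of u'] by (auto simp: col_def split: if_splits)
        then have su: "side u' = side u" using uj uv(2) by (simp add: col_def)
        have u: "f (side u) (\<rho> u) \<le> 0" "f (side u) (\<rho> u') \<le> 0" "side u < 3"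
          using side[OF Pj[of u]] side[OF Pj[of u']] uj uj' su uv(1) by auto
        show ?thesis
        proof (cases "idx v = j")
          case vj: True
          then have vj': "idx v' = j" using uv(1,3) small[of v'] by (auto simp: col_def split: if_splits)
          then have sv: "side v' = side v" using vj uv(3) by (simp add: col_def)
          \<comment> \<open>The side with the smaller number separates: vertices whose first
            violated side comes later are still strictly positive there.\<close>
          have "side v < side u" using uv(4) uj vj by (simp add: col_def)
          then have v: "f (side v) (\<rho> u) > 0" "f (side v) (\<rho> u') > 0"
            "f (side v) (\<rho> v) \<le> 0" "f (side v) (\<rho> v') \<le> 0"
            using side[OF Pj[of u]] side[OF Pj[of u']] side[OF Pj[of v]] side[OF Pj[of v']]
              uj uj' vj vj' su sv uv(1) by auto
          show ?thesis using split[OF v(3,4,1,2)] by blast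
        next
          case vj: False
          then have "idx v' \<noteq> j" using uv(1,3) small[of v] by (auto simp: col_def split: if_splits)
          then show ?thesis using split[OF u(1,2)] others[of v "side u"] others[of v' "side u"] u(3) vj uv(1) by auto
        qed
      next
        case uj: False
        then have "idx v \<noteq> j" using uv(1,4) small[of u] by (auto simp: col_def split: if_splits)
        moreover from uj have uj': "idx u' \<noteq> j" "idx u' = idx u"
          using uv(1,2) small[of u] by (auto simp: col_def split: if_splits)
        moreover have "idx v' \<noteq> j" "idx v' = idx v"
          using uv(1,3) small[of v] \<open>idx v \<noteq> j\<close> by (auto simp: col_def split: if_splits)
        moreover have "\<not> inverted (idx w)" if "w \<in> V" "idx w \<noteq> j" for w
          using inverted_unique[OF j, of "idx w"] small[OF that(1)] that(2) by blast
        ultimately show ?thesis using outs[of u u' v v'] uv uj by (auto simp: col_def)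
      qed
    qed
    show ?thesis
    proof (rule that[of col])
      \<comment> \<open>The index \<open>j\<close> is vacated as a colour, which leaves
        \<open>k - 1\<close> parts and three classes.\<close>
      have "col ` V \<subseteq> ({..<k} - {j}) \<union> {k..<k + 3}"
      proof
        fix x assume "x \<in> col ` V"
        then obtain v where v: "v \<in> V" "x = col v" by blast
        show "x \<in> ({..<k} - {j}) \<union> {k..<k + 3}"
        proof (cases "idx v = j")
          case True
          then show ?thesis using side(1)[OF Pj[OF v(1) True]] v(2) by (simp add: col_def)
        next
          case False
          then show ?thesis using idx[OF v(1)] v(2) by (simp add: col_def)
        qed
      qed
      then have "card (col ` V) \<le> card (({..<k} - {j}) \<union> {k..<k + 3})" by (intro card_mono) auto
      also have "\<dots> \<le> card ({..<k} - {j}) + card {k..<k + 3}" by (rule card_Un_le)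
      also have "\<dots> = k + 2" using j(1) by simp
      finally show "card (col ` V) \<le> k + 2" .
      show "i = l" if "i < k" "l < k" "u \<in> P i" "v \<in> P l" "col u = col v" for u v i l
        using that idx_eq[OF that(1,3)] idx_eq[OF that(2,4)] by (auto simp: col_def split: if_splits)
      show "col u = col v" if "{u, u', v, v'} \<subseteq> V" "col u = col u'" "col v = col v'"
        "closed_segment (\<rho> u) (\<rho> u') \<inter> closed_segment (\<rho> v) (\<rho> v') \<noteq> {}" for u u' v v'
        using less[of u u' v v'] less[of v v' u u'] that by (metis Int_commute linorder_neqE_nat insert_commute)
    qed
  qed
qed

end

section \<open>Counting fixed vertices\<close>

text \<open>A fixed vertex is drawn at the boundary point with its number, so alternating positions
  of two colours would give meeting segments and the colours agree. Equal colours mean equal parts,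
  hence numbers congruent modulo \<open>k\<close>. At most \<open>k + 2\<close> colours thus allow
  fewer than \<open>2 * k + 2\<close> fixed vertices.\<close>

lemma fixed_vertices_bound:
  fixes q :: "'v \<Rightarrow> nat"
  assumes "scattered_triangulations k V E pos crv P"
    and straight: "plane_straight_line_drawing V E \<rho>"
    and q: "bij_betw q V {..<k * k}" "\<And>i v. i < k \<Longrightarrow> v \<in> P i \<Longrightarrow> q v mod k = i"
    and cross: "\<And>a b c d. a < b \<Longrightarrow> b < c \<Longrightarrow> c < d \<Longrightarrow> d < k * k \<Longrightarrow>
       closed_segment (x a) (x c) \<inter> closed_segment (x b) (x d) \<noteq> {}"
  shows "card {v \<in> V. \<rho> v = x (q v)} \<le> 2 * k + 1"
proof -
  interpret drawn_scattered_triangulations k V E pos crv P \<rho>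
    using assms(1) straight by (simp add: drawn_scattered_triangulations_def
        drawn_scattered_triangulations_axioms_def)
  obtain col :: "'v \<Rightarrow> nat" where col: "card (col ` V) \<le> k + 2"
    "\<And>u v i j. i < k \<Longrightarrow> j < k \<Longrightarrow> u \<in> P i \<Longrightarrow> v \<in> P j \<Longrightarrow> col u = col v \<Longrightarrow> i = j"
    "\<And>u u' v v'. {u, u', v, v'} \<subseteq> V \<Longrightarrow> col u = col u' \<Longrightarrow> col v = col v' \<Longrightarrow>
       closed_segment (\<rho> u) (\<rho> u') \<inter> closed_segment (\<rho> v) (\<rho> v') \<noteq> {} \<Longrightarrow> col u = col v"
    using separated_classes by blast
  define S where "S = {v \<in> V. \<rho> v = x (q v)}"
  define r where "r = inv_into V q"
  have injq: "inj_on q V" using q(1) by (simp add: bij_betw_def)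
  have r: "r (q v) = v" if "v \<in> V" for v
    using that injq by (simp add: r_def)
  have SV: "S \<subseteq> V" by (auto simp: S_def)
  have finV: "finite V" using graph by (simp add: simple_graph_def)
  have rS: "r a \<in> S" "q (r a) = a" "\<rho> (r a) = x a" if "a \<in> q ` S" for a
    using that r SV by (auto simp: S_def)
  have "card (q ` S) < card ((\<lambda>a. col (r a)) ` q ` S) + k"
  proof (rule noncrossing_card_square)
    show "q ` S \<subseteq> {..<k * k}" using q(1) SV by (auto simp: bij_betw_def)
    show "k > 0" using k4 by simp
    show "k dvd b - a" if ab: "a \<in> q ` S" "b \<in> q ` S" "a < b" "col (r a) = col (r b)" for a b
    proof -
      have "r a \<in> V" "r b \<in> V" using rS(1) ab SV by blast+
      then obtain i j where ij: "i < k" "r a \<in> P i" "j < k" "r b \<in> P j" using V by blast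
      then have "i = j" using col(2) ab(4) by blast
      then have "a mod k = b mod k"
        using q(2)[OF ij(1,2)] q(2)[OF ij(3,4)] rS(2) ab by simp
      then show ?thesis using ab(3) by (metis less_imp_le_nat mod_eq_dvd_iff_nat)
    qed
    show "col (r a) = col (r b)"
      if h: "{a, b, c, d} \<subseteq> q ` S" "a < b" "b < c" "c < d" "col (r a) = col (r c)" "col (r b) = col (r d)"
      for a b c d
    proof (rule col(3)[OF _ h(5,6)])
      have mem: "a \<in> q ` S" "b \<in> q ` S" "c \<in> q ` S" "d \<in> q ` S" using h(1) by simp_all
      then show "{r a, r c, r b, r d} \<subseteq> V" using rS(1) SV by (simp add: subset_iff)
      have "q ` S \<subseteq> {..<k * k}" using q(1) SV by (auto simp: bij_betw_def)
      then have "d < k * k" using mem(4) by blast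
      then show "closed_segment (\<rho> (r a)) (\<rho> (r c)) \<inter> closed_segment (\<rho> (r b)) (\<rho> (r d)) \<noteq> {}"
        using cross[OF h(2-4)] by (simp add: rS(3)[OF mem(1)] rS(3)[OF mem(2)] rS(3)[OF mem(3)] rS(3)[OF mem(4)])
    qed
  qed
  moreover have "card ((\<lambda>a. col (r a)) ` q ` S) \<le> card (col ` V)"
    using rS(1) SV finV by (intro card_mono) auto
  moreover have "card (q ` S) = card S"
    by (rule card_image[OF inj_on_subset[OF injq SV]])
  ultimately show ?thesis using col(1) by (simp add: S_def)
qed

text \<open>For \<open>k = 3\<close> the parts are single triangles, and an inner facial triangle need not be
  non-separating. But eight fixed vertices would fix two whole triangles, whose edges cross.\<close>

lemma fixed_vertices_bound_3:
  fixes q :: "'v \<Rightarrow> nat"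
  assumes V: "V = (\<Union>i<3. P i)" and P: "\<And>i. i < 3 \<Longrightarrow> card (P i) = 3"
    and tri: "\<And>i. i < 3 \<Longrightarrow> plane_triangulation (P i) (induced_edges E (P i)) pos crv"
    and graph: "simple_graph V E" and straight: "plane_straight_line_drawing V E \<rho>"
    and q: "bij_betw q V {..<9}" "\<And>i v. i < 3 \<Longrightarrow> v \<in> P i \<Longrightarrow> q v mod 3 = i"
    and cross: "\<And>a b c d. a < b \<Longrightarrow> b < c \<Longrightarrow> c < d \<Longrightarrow> d < 9 \<Longrightarrow>
       closed_segment (x a) (x c) \<inter> closed_segment (x b) (x d) \<noteq> {}"
  shows "card {v \<in> V. \<rho> v = x (q v)} \<le> 7"
proof (rule ccontr)
  interpret straight_drawing V E \<rho> using graph straight by unfold_locales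
  define S where "S = {v \<in> V. \<rho> v = x (q v)}"
  assume "\<not> card {v \<in> V. \<rho> v = x (q v)} \<le> 7"
  then have S8: "card S \<ge> 8" by (simp add: S_def)
  have finV: "finite V" using graph by (simp add: simple_graph_def)
  have "card V = 9" using bij_betw_same_card[OF q(1)] by simp
  moreover have "S \<subseteq> V" by (auto simp: S_def)
  ultimately have "card (V - S) \<le> 1"
    using S8 finV by (simp add: card_Diff_subset finite_subset)
  then obtain w where w: "V - S \<subseteq> {w}"
    using finV by (metis card_le_Suc0_iff_eq One_nat_def finite_Diff insertI1 subsetI)
  \<comment> \<open>Only \<open>w\<close> can be moved, so the two parts other than the one with
    residue \<open>l\<close> are fixed entirely.\<close>
  define l where "l = q w mod 3"
  have at: "\<exists>v\<in>P i. q v = a" if a: "a mod 3 = i" "a < 9" for a i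
  proof -
    have "a \<in> q ` V" using q(1) a(2) by (simp add: bij_betw_def)
    then obtain v where v: "v \<in> V" "q v = a" by blast
    then obtain j where "j < 3" "v \<in> P j" using V by blast
    then show ?thesis using q(2)[of j v] v a(1) by auto
  qed
  have fixed: "\<rho> v = x (q v)" if "i < 3" "i \<noteq> l" "v \<in> P i" for i v
  proof -
    have "v \<in> V" using that V by blast
    moreover have "v \<noteq> w" using q(2)[OF that(1,3)] that(2) l_def by blast
    ultimately show ?thesis using w by (auto simp: S_def)
  qed
  have adj: "{u, v} \<in> E" if i: "i < 3" and uv: "u \<in> P i" "v \<in> P i" "u \<noteq> v" for i u v
  proof -
    interpret T: triangulated_plane "P i" "induced_edges E (P i)" pos crv
      using tri[OF i] by unfold_locales
    obtain t where t: "facial (P i) (induced_edges E (P i)) pos crv (outside (plane_image (P i) (induced_edges E (P i)) pos crv)) t"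
      by (rule T.outer_facial)
    have "finite (P i)" using P[OF i] by (metis card.infinite zero_neq_numeral)
    then have "t = P i" using T.facialD(5,6)[OF t] P[OF i] by (simp add: card_subset_eq)
    then show ?thesis using T.facialD(7)[OF t, of "{u, v}"] uv by (simp add: induced_edges_def)
  qed
  obtain i j where ij: "i < j" "j < 3" "i \<noteq> l" "j \<noteq> l"
  proof -
    have "l < 3" by (simp add: l_def)
    then consider "l = 0" | "l = 1" | "l = 2" by linarith
    then show ?thesis by cases (use that[of 1 2] that[of 0 2] that[of 0 1] in auto)
  qed
  \<comment> \<open>Since \<open>i < j < 3\<close>, the positions \<open>i\<close>,
    \<open>j\<close>, \<open>i + 3\<close>, \<open>j + 3\<close> alternate between the two parts, so
    two disjoint edges are drawn as meeting chords.\<close>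
  obtain u u' v v' where uv: "u \<in> P i" "q u = i" "u' \<in> P i" "q u' = i + 3" "v \<in> P j" "q v = j" "v' \<in> P j" "q v' = j + 3"
    using at[of i i] at[of "i + 3" i] at[of j j] at[of "j + 3" j] ij by (auto simp: mod_add_self2)
  then have "u \<noteq> u'" "v \<noteq> v'" by auto
  then have "{u, u'} \<in> E" "{v, v'} \<in> E" using adj[of i u u'] adj[of j v v'] uv ij by auto
  moreover have "{u, u'} \<inter> {v, v'} = {}" using uv ij by auto
  ultimately have "closed_segment (\<rho> u) (\<rho> u') \<inter> closed_segment (\<rho> v) (\<rho> v') = {}"
    by (rule disjoint_edges)
  moreover have "\<rho> u = x i" "\<rho> u' = x (i + 3)" "\<rho> v = x j" "\<rho> v' = x (j + 3)"
    using fixed[of i u] fixed[of i u'] fixed[of j v] fixed[of j v'] uv ij by auto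
  ultimately show False using cross[of i j "i + 3" "j + 3"] ij by simp
qed

text \<open>The remainder modulo \<open>k\<close> names the part, and the quotient enumerates the
  vertices within it.\<close>

lemma interleaved_numbering:
  fixes P :: "nat \<Rightarrow> 'v set"
  assumes V: "V = (\<Union>i<k. P i)" and disj: "\<forall>i<k. \<forall>j<k. i \<noteq> j \<longrightarrow> P i \<inter> P j = {}"
    and card: "\<forall>i<k. card (P i) = k" "card V = k * k"
  obtains q :: "'v \<Rightarrow> nat" where "bij_betw q V {..<k * k}" "\<And>i v. i < k \<Longrightarrow> v \<in> P i \<Longrightarrow> q v mod k = i"
proof -
  have "\<exists>h. bij_betw h (P i) {..<k}" if "i < k" for i
  proof -
    have "finite (P i)" using card that by (metis card.infinite not_less0)
    then show ?thesis using finite_same_card_bij[of "P i" "{..<k}"] card(1) that by auto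
  qed
  then obtain h where h: "\<And>i. i < k \<Longrightarrow> bij_betw (h i) (P i) {..<k}" by metis
  have "\<exists>i<k. v \<in> P i" if "v \<in> V" for v using that V by blast
  then obtain idx where idx: "\<And>v. v \<in> V \<Longrightarrow> idx v < k \<and> v \<in> P (idx v)" by metis
  have idx_eq: "idx v = i" if "i < k" "v \<in> P i" for v i
    using disj idx[of v] that V by blast
  define q where "q v = h (idx v) v * k + idx v" for v
  have hk: "h (idx v) v < k" if "v \<in> V" for v
    using h[of "idx v"] idx[OF that] by (auto simp: bij_betw_def)
  have mod: "q v mod k = idx v" "q v div k = h (idx v) v" if "v \<in> V" for v
    using idx[OF that] by (auto simp: q_def)
  have "inj_on q V"
  proof (rule inj_onI)
    fix u v assume uv: "u \<in> V" "v \<in> V" "q u = q v"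
    then have "idx u = idx v" "h (idx u) u = h (idx v) v" using mod by metis+
    then show "u = v" using h[of "idx u"] idx uv by (metis bij_betw_def inj_onD)
  qed
  moreover have "q ` V \<subseteq> {..<k * k}"
  proof
    fix a assume "a \<in> q ` V"
    then obtain v where v: "v \<in> V" "a = q v" by blast
    have "q v < (h (idx v) v + 1) * k" using idx[OF v(1)] by (simp add: q_def)
    also have "\<dots> \<le> k * k" using hk[OF v(1)] by (intro mult_le_mono1) simp
    finally show "a \<in> {..<k * k}" using v by simp
  qed
  ultimately have "bij_betw q V {..<k * k}"
    using card(2) by (simp add: bij_betw_def card_image card_subset_eq)
  moreover have "q v mod k = i" if "i < k" "v \<in> P i" for i v
    using mod(1)[of v] idx_eq[OF that] that V by blast
  ultimately show ?thesis by (rule that)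
qed

theorem theoremA1:
  fixes k n :: nat
    and V :: "'v set" and E :: "'v set set"
    and pos :: "'v \<Rightarrow> complex" and crv :: "'v set \<Rightarrow> real \<Rightarrow> complex"
    and P :: "nat \<Rightarrow> 'v set"
    and K X :: "complex set"
  assumes "k \<ge> 3" and "n = k\<^sup>2"
    and "plane_graph V E pos crv"
    and "vertex_connected 3 V E"
    and "card V = n"
    and "V = (\<Union>i<k. P i)"
    and "\<forall>i<k. \<forall>j<k. i \<noteq> j \<longrightarrow> P i \<inter> P j = {}"
    and "\<forall>i<k. card (P i) = k"
    and "\<forall>i<k. plane_triangulation (P i) (induced_edges E (P i)) pos crv"
    and "\<forall>i<k. \<forall>j<k. i \<noteq> j \<longrightarrow>
           plane_image (P j) (induced_edges E (P j)) pos crv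
             \<subseteq> outer_face (P i) (induced_edges E (P i)) pos crv"
    and "convex_body K"
    and "X \<subseteq> frontier K" and "finite X" and "card X = n"
  shows "\<exists>\<pi>. drawing V \<pi> \<and> \<pi> ` V \<subseteq> X \<and>
             real (fix_count V E \<pi>) \<le> 2 * sqrt (real n) + 1"
proof -
  note asm = assms
  have pg: "simple_graph V E" using asm(3) by (simp add: plane_graph_def)
  have n: "n = k * k" using asm(2) by (simp add: power2_eq_square)
  obtain x where x: "bij_betw x {..<card X} X"
    and cross: "\<And>p q r s. p < q \<Longrightarrow> q < r \<Longrightarrow> r < s \<Longrightarrow> s < card X \<Longrightarrow>
       closed_segment (x p) (x r) \<inter> closed_segment (x q) (x s) \<noteq> {}"
    by (rule convex_body_boundary_order[OF asm(11-13)]) blast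
  obtain q where q: "bij_betw q V {..<k * k}" "\<And>i v. i < k \<Longrightarrow> v \<in> P i \<Longrightarrow> q v mod k = i"
    using interleaved_numbering[OF asm(6-8)] asm(5) n by metis
  define \<pi> where "\<pi> v = x (q v)" for v
  have bij: "bij_betw \<pi> V X"
    using bij_betw_trans[OF q(1), of x X] x asm(14) n by (simp add: \<pi>_def[abs_def] comp_def)
  have bound: "card {v \<in> V. \<rho> v = \<pi> v} \<le> 2 * k + 1"
    if straight: "plane_straight_line_drawing V E \<rho>" for \<rho>
  proof (cases "k = 3")
    case True
    have "card {v \<in> V. \<rho> v = x (q v)} \<le> 7"
    proof (rule fixed_vertices_bound_3[OF _ _ _ pg straight])
      show "V = (\<Union>i<3. P i)" using asm(6) True by simp
      show "bij_betw q V {..<9}" using q(1) True by simp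
      show "closed_segment (x a) (x c) \<inter> closed_segment (x b) (x d) \<noteq> {}"
        if "a < b" "b < c" "c < d" "d < 9" for a b c d
        using cross[OF that(1-3)] that(4) asm(14) n True by simp
    qed (use asm(8,9) q(2) True in auto)
    then show ?thesis using True by (simp add: \<pi>_def)
  next
    case False
    have "scattered_triangulations k V E pos crv P"
      using asm(1) False by unfold_locales (use asm(3-10) in auto)
    then show ?thesis
      unfolding \<pi>_def
      by (rule fixed_vertices_bound[OF _ straight q]) (use cross asm(14) n in auto)
  qed
  have "fix_count V E \<pi> \<le> 2 * k + 1"
  proof (cases "{p'. plane_straight_line_drawing V E p'} = {}")
    case False
    then show ?thesis unfolding fix_count_def using bound by (intro cSUP_least) auto
  \<comment> \<open>If there were no plane straight line drawing, the supremum of the empty set of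
    naturals would be 0.\<close>
  qed (simp add: fix_count_def Sup_nat_def)
  moreover have "sqrt (real n) = real k" using asm(2) by simp
  ultimately have "real (fix_count V E \<pi>) \<le> 2 * sqrt (real n) + 1" by simp
  moreover have "drawing V \<pi>" "\<pi> ` V \<subseteq> X" using bij by (auto simp: drawing_def bij_betw_def)
  ultimately show ?thesis by blast
qed

end
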